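(* Let $k\in\mathbb N$, let $m\in\mathbb Q$, and let $G$ be a graph such that $|\Omega(G)|\leq\aleph_0$ and $\delta^{V,\Omega}(G)> m$. Then $K^{k}\preceq_{top}G$ (i.e. $G$ contains a subdivision of the complete graph $K^k$), or $G$ has a finite subgraph of average degree greater than $m-k+1$.
   Context: Graphs are simple and may be infinite. A ray is a one-way infinite path. A set $S$ of vertices separates two rays $R_1,R_2$ if $V(R_1)\setminus S$ and $V(R_2)\setminus S$ lie in different components of $G-S$; two rays are equivalent if no finite vertex set separates them, and the ends of $G$ are the equivalence classes; $\Omega(G)$ is the set of ends. A vertex $v$ dominates a ray $R$ if there are infinitely many $v$–$V(R)$ paths that are pairwise disjoint except in $v$; $v$ dominates an end $\omega$ if it dominates some ray of $\omega$; $Dom(\omega)$ is the set of vertices dominating $\omega$. For $H\subseteq G$, $\Omega^G(H)$ is the set of ends of $G$ having a ray in $H$. For $V'\subseteq V(G)$ and $\Omega'\subseteq\Omega(G)$, a $V'$–$\Omega'$ separator is a set $S\subseteq V(G)$ with $V'\not\subseteq S$ such that no component of $G-S$ contains both a vertex of $V'$ and a ray of an end in $\Omega'$. For a subgraph $H$, the edge-boundary is $\partial_e H=E(H,G-H)$ and the vertex-boundary $\partial_v H$ is the set of vertices of $H$ having a neighbour in $G-H$. For an end $\omega$ of a graph, an $\omega$-region is an induced connected subgraph containing a ray of $\omega$ and having finite vertex-boundary. Write $(H_i)_{i\in\mathbb N}\to\omega$ if $(H_i)$ is an infinite sequence of distinct $\omega$-regions such that for every $i$, $H_{i+1}\subseteq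 H_i-\partial_vH_i$ and $\partial_vH_{i+1}$ is an inclusion-minimal $\partial_vH_i$–$\Omega(H_{i+1})$ separator (ends of the ambient graph having a ray in $H_{i+1}$). Relative degree of an end $\omega$ of $G$: let $G_\omega:=G-Dom(\omega)$. If $G_\omega$ contains no ray of $\omega$ or $|Dom(\omega)|\ge\aleph_0$, set $d_{e/v}(\omega):=|Dom(\omega)|$. Otherwise let $\hat\omega$ be the unique end of $G_\omega$ containing rays of $\omega$ and set $d_{e/v}(\omega):=|Dom(\omega)|+\inf_{(\hat H_i)\to\hat\omega}\liminf_{i\to\infty}|\partial_e\hat H_i|/|\partial_v\hat H_i|$, where the infimum is over sequences of $\hat\omega$-regions of $G_\omega$ converging to $\hat\omega$ in $G_\omega$ and boundaries are taken in $G_\omega$. $\delta^{V,\Omega}(G)$ denotes the minimum of all vertex degrees of $G$ and all relative degrees $d_{e/v}(\omega)$, $\omega\in\Omega(G)$ (so $\delta^{V,\Omega}(G)>m$ means every vertex degree and every end's relative degree exceeds $m$). *)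

theory Defs
  imports
    Complex_Main
    "HOL-Library.Countable_Set"
    "HOL-Library.Extended_Real"
    "HOL-Library.Liminf_Limsup"
begin

section \<open>Simple graphs, possibly infinite\<close>

record 'a ugraph =
  verts :: "'a set"
  edges :: "'a set set"

definition simple_graph :: "'a ugraph \<Rightarrow> bool" where
  "simple_graph G \<longleftrightarrow>
     (\<forall>e\<in>edges G. \<exists>u\<in>verts G. \<exists>v\<in>verts G. u \<noteq> v \<and> e = {u, v})"

definition adj :: "'a ugraph \<Rightarrow> 'a \<Rightarrow> 'a \<Rightarrow> bool" where
  "adj G u v \<longleftrightarrow> {u, v} \<in> edges G"

definition nbhd :: "'a ugraph \<Rightarrow> 'a \<Rightarrow> 'a set" where
  "nbhd G v = {w \<in> verts G. adj G v w}"

definition is_subgraph :: "'a ugraph \<Rightarrow> 'a ugraph \<Rightarrow> bool" where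
  "is_subgraph H G \<longleftrightarrow>
     simple_graph H \<and> verts H \<subseteq> verts G \<and> edges H \<subseteq> edges G"

definition induce :: "'a ugraph \<Rightarrow> 'a set \<Rightarrow> 'a ugraph" where
  "induce G U = \<lparr>verts = verts G \<inter> U, edges = {e \<in> edges G. e \<subseteq> U}\<rparr>"

definition del_verts :: "'a ugraph \<Rightarrow> 'a set \<Rightarrow> 'a ugraph" where
  "del_verts G S = induce G (verts G - S)"

text \<open>All infinite cardinalities are identified with \<open>\<infinity>\<close>; cardinalities are only
  ever compared with rational numbers.\<close>

definition ecard :: "'a set \<Rightarrow> enat" where
  "ecard A = (if finite A then enat (card A) else \<infinity>)"

definition vdegree :: "'a ugraph \<Rightarrow> 'a \<Rightarrow> enat" where
  "vdegree G v = ecard (nbhd G v)"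

text \<open>Only meaningful for finite nonempty graphs.\<close>

definition average_degree :: "'a ugraph \<Rightarrow> rat" where
  "average_degree G =
     (\<Sum>v\<in>verts G. of_nat (card (nbhd G v))) / of_nat (card (verts G))"


section \<open>Paths, components, subdivisions\<close>

definition is_path :: "'a ugraph \<Rightarrow> 'a list \<Rightarrow> bool" where
  "is_path G p \<longleftrightarrow>
     p \<noteq> [] \<and> distinct p \<and> set p \<subseteq> verts G \<and> successively (adj G) p"

definition path_edges :: "'a list \<Rightarrow> 'a set set" where
  "path_edges p = {{p ! i, p ! Suc i} |i. Suc i < length p}"

definition inner_vertices :: "'a list \<Rightarrow> 'a set" where
  "inner_vertices p = set p - {hd p, last p}"

definition linked :: "'a ugraph \<Rightarrow> 'a \<Rightarrow> 'a \<Rightarrow> bool" where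
  "linked G u v \<longleftrightarrow> (\<exists>p. is_path G p \<and> hd p = u \<and> last p = v)"

definition connected_graph :: "'a ugraph \<Rightarrow> bool" where
  "connected_graph G \<longleftrightarrow>
     verts G \<noteq> {} \<and> (\<forall>u\<in>verts G. \<forall>v\<in>verts G. linked G u v)"

text \<open>Components are represented by their vertex sets.\<close>

definition comps :: "'a ugraph \<Rightarrow> 'a set set" where
  "comps G = (\<lambda>u. {v. linked G u v}) ` verts G"

text \<open>\<open>T\<close> arises from \<open>X\<close> by replacing every edge \<open>e\<close> by a path \<open>P e\<close> joining its two
  ends; \<open>\<phi>\<close> maps the vertices of \<open>X\<close> to the branch vertices.\<close>

definition is_subdivision :: "'b ugraph \<Rightarrow> 'a ugraph \<Rightarrow> bool" where
  "is_subdivision X T \<longleftrightarrow>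
     (\<exists>(\<phi> :: 'b \<Rightarrow> 'a) (P :: 'b set \<Rightarrow> 'a list).
        inj_on \<phi> (verts X) \<and>
        (\<forall>e\<in>edges X. is_path T (P e) \<and> {hd (P e), last (P e)} = \<phi> ` e) \<and>
        (\<forall>e\<in>edges X. inner_vertices (P e) \<inter> \<phi> ` verts X = {}) \<and>
        (\<forall>e\<in>edges X. \<forall>f\<in>edges X. e \<noteq> f \<longrightarrow> inner_vertices (P e) \<inter> set (P f) = {}) \<and>
        verts T = \<phi> ` verts X \<union> (\<Union>e\<in>edges X. set (P e)) \<and>
        edges T = (\<Union>e\<in>edges X. path_edges (P e)))"

definition top_minor :: "'b ugraph \<Rightarrow> 'a ugraph \<Rightarrow> bool" where
  "top_minor X G \<longleftrightarrow> (\<exists>T. is_subgraph T G \<and> is_subdivision X T)"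

definition complete_graph :: "nat \<Rightarrow> nat ugraph" where
  "complete_graph k =
     \<lparr>verts = {..<k}, edges = {{i, j} |i j. i < k \<and> j < k \<and> i \<noteq> j}\<rparr>"


section \<open>Rays and ends\<close>

text \<open>A ray is identified with the enumeration of its vertices from its starting vertex,
  so that its vertex set is \<open>range R\<close>. An end is a set of rays.\<close>

definition is_ray :: "'a ugraph \<Rightarrow> (nat \<Rightarrow> 'a) \<Rightarrow> bool" where
  "is_ray G R \<longleftrightarrow> inj R \<and> range R \<subseteq> verts G \<and> (\<forall>n. adj G (R n) (R (Suc n)))"

definition separates_rays ::
  "'a ugraph \<Rightarrow> 'a set \<Rightarrow> (nat \<Rightarrow> 'a) \<Rightarrow> (nat \<Rightarrow> 'a) \<Rightarrow> bool" where
  "separates_rays G S R R' \<longleftrightarrow>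
     (\<exists>C\<in>comps (del_verts G S). \<exists>C'\<in>comps (del_verts G S).
        C \<noteq> C' \<and> range R - S \<subseteq> C \<and> range R' - S \<subseteq> C')"

definition ray_equiv :: "'a ugraph \<Rightarrow> ((nat \<Rightarrow> 'a) \<times> (nat \<Rightarrow> 'a)) set" where
  "ray_equiv G =
     {(R, R'). is_ray G R \<and> is_ray G R' \<and>
        \<not> (\<exists>S. finite S \<and> S \<subseteq> verts G \<and> separates_rays G S R R')}"

definition graph_ends :: "'a ugraph \<Rightarrow> (nat \<Rightarrow> 'a) set set" where
  "graph_ends G = {R. is_ray G R} // ray_equiv G"

text \<open>A path from \<open>v\<close> to a set \<open>W\<close> meets \<open>W\<close> only in its last vertex.\<close>

definition vertex_set_path :: "'a ugraph \<Rightarrow> 'a \<Rightarrow> 'a set \<Rightarrow> 'a list \<Rightarrow> bool" where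
  "vertex_set_path G v W p \<longleftrightarrow> is_path G p \<and> hd p = v \<and> set p \<inter> W = {last p}"

definition dominates_ray :: "'a ugraph \<Rightarrow> 'a \<Rightarrow> (nat \<Rightarrow> 'a) \<Rightarrow> bool" where
  "dominates_ray G v R \<longleftrightarrow>
     (\<exists>\<P>. infinite \<P> \<and> (\<forall>p\<in>\<P>. vertex_set_path G v (range R) p) \<and>
        (\<forall>p\<in>\<P>. \<forall>q\<in>\<P>. p \<noteq> q \<longrightarrow> set p \<inter> set q = {v}))"

definition Dom :: "'a ugraph \<Rightarrow> (nat \<Rightarrow> 'a) set \<Rightarrow> 'a set" where
  "Dom G \<omega> = {v \<in> verts G. \<exists>R\<in>\<omega>. dominates_ray G v R}"

definition ends_of_subgraph :: "'a ugraph \<Rightarrow> 'a ugraph \<Rightarrow> (nat \<Rightarrow> 'a) set set" where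
  "ends_of_subgraph G H = {\<omega> \<in> graph_ends G. \<exists>R\<in>\<omega>. is_ray H R}"

definition is_separator ::
  "'a ugraph \<Rightarrow> 'a set \<Rightarrow> (nat \<Rightarrow> 'a) set set \<Rightarrow> 'a set \<Rightarrow> bool" where
  "is_separator G V' \<Omega>' S \<longleftrightarrow>
     S \<subseteq> verts G \<and> \<not> V' \<subseteq> S \<and>
     \<not> (\<exists>C\<in>comps (del_verts G S).
          C \<inter> V' \<noteq> {} \<and> (\<exists>\<omega>\<in>\<Omega>'. \<exists>R\<in>\<omega>. range R \<subseteq> C))"

definition is_minimal_separator ::
  "'a ugraph \<Rightarrow> 'a set \<Rightarrow> (nat \<Rightarrow> 'a) set set \<Rightarrow> 'a set \<Rightarrow> bool" where
  "is_minimal_separator G V' \<Omega>' S \<longleftrightarrow>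
     is_separator G V' \<Omega>' S \<and> (\<forall>S'. S' \<subset> S \<longrightarrow> \<not> is_separator G V' \<Omega>' S')"


section \<open>Regions and the relative degree of an end\<close>

definition edge_boundary :: "'a ugraph \<Rightarrow> 'a ugraph \<Rightarrow> 'a set set" where
  "edge_boundary G H =
     {e \<in> edges G. \<exists>u\<in>verts H. \<exists>v\<in>verts G - verts H. e = {u, v}}"

definition vertex_boundary :: "'a ugraph \<Rightarrow> 'a ugraph \<Rightarrow> 'a set" where
  "vertex_boundary G H = {u \<in> verts H. \<exists>v\<in>verts G - verts H. adj G u v}"

definition is_region :: "'a ugraph \<Rightarrow> (nat \<Rightarrow> 'a) set \<Rightarrow> 'a ugraph \<Rightarrow> bool" where
  "is_region G \<omega> H \<longleftrightarrow>
     is_subgraph H G \<and> H = induce G (verts H) \<and> connected_graph H \<and>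
     (\<exists>R\<in>\<omega>. is_ray H R) \<and> finite (vertex_boundary G H)"

definition converges_to_end ::
  "'a ugraph \<Rightarrow> (nat \<Rightarrow> 'a ugraph) \<Rightarrow> (nat \<Rightarrow> 'a) set \<Rightarrow> bool" where
  "converges_to_end G H \<omega> \<longleftrightarrow>
     inj H \<and>
     (\<forall>i. is_region G \<omega> (H i)) \<and>
     (\<forall>i. is_subgraph (H (Suc i)) (del_verts (H i) (vertex_boundary G (H i)))) \<and>
     (\<forall>i. is_minimal_separator G (vertex_boundary G (H i))
            (ends_of_subgraph G (H (Suc i))) (vertex_boundary G (H (Suc i))))"

definition undominated_part :: "'a ugraph \<Rightarrow> (nat \<Rightarrow> 'a) set \<Rightarrow> 'a ugraph" where
  "undominated_part G \<omega> = del_verts G (Dom G \<omega>)"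

definition induced_end :: "'a ugraph \<Rightarrow> (nat \<Rightarrow> 'a) set \<Rightarrow> (nat \<Rightarrow> 'a) set" where
  "induced_end G \<omega> =
     (THE \<omega>'. \<omega>' \<in> graph_ends (undominated_part G \<omega>) \<and> \<omega>' \<inter> \<omega> \<noteq> {})"

text \<open>If no sequence of regions converges, the infimum is \<open>\<infinity>\<close>. Along a converging sequence the
  denominators are nonzero, as a separator never contains all of \<open>V'\<close>; edge-boundaries may be
  infinite.\<close>

definition relative_degree :: "'a ugraph \<Rightarrow> (nat \<Rightarrow> 'a) set \<Rightarrow> ereal" where
  "relative_degree G \<omega> =
     (if (\<nexists>R. R \<in> \<omega> \<and> is_ray (undominated_part G \<omega>) R) \<or> infinite (Dom G \<omega>)
      then ereal_of_enat (ecard (Dom G \<omega>))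
      else ereal_of_enat (ecard (Dom G \<omega>)) +
        (INF H\<in>{H. converges_to_end (undominated_part G \<omega>) H (induced_end G \<omega>)}.
           liminf (\<lambda>i.
             ereal_of_enat (ecard (edge_boundary (undominated_part G \<omega>) (H i))) /
             ereal_of_enat (ecard (vertex_boundary (undominated_part G \<omega>) (H i))))))"

text \<open>\<open>\<delta>\<^sup>V\<^sup>,\<^sup>\<Omega>(G) > m\<close>. Written out pointwise: every vertex degree and every relative degree
  exceeds \<open>m\<close>. The strict inequality for the infimum over all ends would be stronger when the
  infimum is not attained.\<close>

definition min_degree_VE_gt :: "'a ugraph \<Rightarrow> rat \<Rightarrow> bool" where
  "min_degree_VE_gt G m \<longleftrightarrow>
     (\<forall>v\<in>verts G. ereal_of_enat (vdegree G v) > ereal (of_rat m)) \<and>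
     (\<forall>\<omega>\<in>graph_ends G. relative_degree G \<omega> > ereal (of_rat m))"

end

theory Submission
  imports Defs
begin

text \<open>Suppose the conclusion fails. If a set \<open>C\<close> has finite neighbourhood, then deleting a finite set
  from \<open>C\<close> leaves only finitely many vertices in finite components: otherwise infinitely many finite
  components share the same neighbourhood \<open>N\<close>, the vertices of \<open>N\<close> are pairwise joined by infinitely
  many disjoint paths, so \<open>|N| < k\<close>, and each of these components has average degree above
  \<open>m - k + 1\<close>.

  Call \<open>C\<close> big if it is infinite, connected and has finite neighbourhood. For each end \<open>\<omega>\<close>, every big
  set contains a big set without a ray of \<open>\<omega>\<close>. Otherwise some big \<open>C\<close> stays connected up to finitely
  many vertices after deleting any finite set, so every vertex with infinitely many neighbours in \<open>C\<close>
  dominates \<open>\<omega>\<close>. Outside \<open>Dom \<omega>\<close>, which has fewer than \<open>k\<close> elements, \<open>C\<close> is locally finite and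
  contains a sequence of regions converging to \<open>\<omega>\<close>. The part of \<open>C\<close> not in the interior of the \<open>n\<close>-th
  region is finite; its boundary vertices have average degree above \<open>m - |Dom \<omega>|\<close> by the assumption on
  the relative degree, and each other vertex exceeds this by a fixed \<open>\<epsilon>\<close>, up to a total loss that does
  not depend on \<open>n\<close>. For large \<open>n\<close> this is a finite subgraph of too large average degree.

  Finally, evading the countably many ends one after the other along a decreasing sequence of big
  sets yields a ray that belongs to none of them.\<close>

section \<open>Reachability inside a vertex set\<close>

text \<open>A relational closure rather than a path, so that claims about walks become closure
  arguments via \<open>reach_closed\<close>. The conjunct \<open>u \<in> U\<close> excludes the
  trivial walk at a vertex outside \<open>U\<close>.\<close>

definition reach :: "'a ugraph \<Rightarrow> 'a set \<Rightarrow> 'a \<Rightarrow> 'a \<Rightarrow> bool" where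
  "reach G U u v \<longleftrightarrow> u \<in> U \<and> (\<lambda>x y. adj G x y \<and> x \<in> U \<and> y \<in> U)\<^sup>*\<^sup>* u v"

definition component_of :: "'a ugraph \<Rightarrow> 'a set \<Rightarrow> 'a \<Rightarrow> 'a set" where
  "component_of G U v = {w. reach G U v w}"

definition conn_set :: "'a ugraph \<Rightarrow> 'a set \<Rightarrow> bool" where
  "conn_set G U \<longleftrightarrow> U \<noteq> {} \<and> (\<forall>u\<in>U. \<forall>v\<in>U. reach G U u v)"

definition outer_nbhd :: "'a ugraph \<Rightarrow> 'a set \<Rightarrow> 'a set" where
  "outer_nbhd G C = {v \<in> verts G - C. \<exists>u\<in>C. adj G u v}"

lemma adj_sym: "adj G u v \<Longrightarrow> adj G v u"
  by (simp add: adj_def insert_commute)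

lemma reach_refl: "u \<in> U \<Longrightarrow> reach G U u u"
  by (simp add: reach_def)

lemma reach_closed:
  assumes "reach G U u v" "u \<in> A"
    and "\<And>x y. x \<in> A \<Longrightarrow> x \<in> U \<Longrightarrow> y \<in> U \<Longrightarrow> adj G x y \<Longrightarrow> y \<in> A"
  shows "v \<in> A"
proof -
  have "(\<lambda>x y. adj G x y \<and> x \<in> U \<and> y \<in> U)\<^sup>*\<^sup>* u v" using assms(1) by (simp add: reach_def)
  then show ?thesis by induction (use assms in auto)
qed

lemma reach_in: assumes "reach G U u v" shows "u \<in> U" "v \<in> U"
  using assms reach_closed[OF assms, of U] by (auto simp: reach_def)

lemma reach_step:
  assumes "reach G U u v" "adj G v w" "w \<in> U" shows "reach G U u w"
  using assms reach_in[OF assms(1)] unfolding reach_def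
  by (metis (no_types, lifting) rtranclp.rtrancl_into_rtrancl)

lemma reach_trans: "reach G U u v \<Longrightarrow> reach G U v w \<Longrightarrow> reach G U u w"
  by (auto simp: reach_def)

lemma reach_sym: assumes "reach G U u v" shows "reach G U v u"
proof -
  have "v \<in> {x. reach G U x u}"
  proof (rule reach_closed[OF assms])
    show "u \<in> {x. reach G U x u}" using reach_in(1)[OF assms] by (simp add: reach_refl)
  next
    fix x y assume "x \<in> {x. reach G U x u}" "x \<in> U" "y \<in> U" "adj G x y"
    then show "y \<in> {x. reach G U x u}"
      using reach_trans reach_step reach_refl adj_sym by (metis mem_Collect_eq)
  qed
  then show ?thesis by simp
qed

lemma reach_mono:
  assumes "reach G U u v" "U \<subseteq> W" shows "reach G W u v"
proof -
  have "v \<in> {x. reach G W u x}"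
    by (rule reach_closed[OF assms(1)])
      (use assms reach_in(1)[OF assms(1)] in \<open>auto intro: reach_refl reach_step\<close>)
  then show ?thesis by simp
qed

text \<open>Every vertex passed on the way is itself reachable, so the walk never leaves the
  component.\<close>

lemma reach_component:
  assumes "reach G U u v" shows "reach G (component_of G U u) u v"
proof -
  have "v \<in> {x. reach G (component_of G U u) u x \<and> reach G U u x}"
  proof (rule reach_closed[OF assms])
    show "u \<in> {x. reach G (component_of G U u) u x \<and> reach G U u x}"
      using reach_in(1)[OF assms] by (simp add: reach_refl component_of_def)
  next
    fix x y assume "x \<in> {x. reach G (component_of G U u) u x \<and> reach G U u x}" "x \<in> U" "y \<in> U" "adj G x y"
    then show "y \<in> {x. reach G (component_of G U u) u x \<and> reach G U u x}"
      using reach_step[of G U u x y] reach_step[of G "component_of G U u" u x y]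
      by (auto simp: component_of_def)
  qed
  then show ?thesis by simp
qed

lemma component_of_subset: "component_of G U v \<subseteq> U"
  by (auto simp: component_of_def dest: reach_in)

lemma conn_component: "v \<in> U \<Longrightarrow> conn_set G (component_of G U v)"
  unfolding conn_set_def
  by (metis component_of_def empty_iff mem_Collect_eq reach_component reach_refl reach_sym reach_trans)

lemma component_of_eq: "reach G U u v \<Longrightarrow> component_of G U u = component_of G U v"
  unfolding component_of_def using reach_sym reach_trans by fast

section \<open>Paths, components and induced subgraphs in terms of reachability\<close>

lemma adj_induce: "adj (induce G U) x y \<longleftrightarrow> adj G x y \<and> x \<in> U \<and> y \<in> U"
  by (auto simp: adj_def induce_def)

lemma del_verts_simps:
  "verts (del_verts G S) = verts G - S"
  "adj (del_verts G S) x y \<longleftrightarrow> adj G x y \<and> x \<in> verts G - S \<and> y \<in> verts G - S"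
  by (auto simp: del_verts_def adj_induce) (auto simp: induce_def)

lemma verts_induce: "verts (induce G U) = verts G \<inter> U"
  by (simp add: induce_def)

lemma successively_cong_set:
  assumes "\<And>x y. x \<in> set p \<Longrightarrow> y \<in> set p \<Longrightarrow> P x y = Q x y"
  shows "successively P p \<longleftrightarrow> successively Q p"
  using assms by (induction p rule: induct_list012) auto

lemma is_path_induce: "is_path (induce G U) p \<longleftrightarrow> is_path G p \<and> set p \<subseteq> U"
proof (cases "set p \<subseteq> U")
  case True
  then have "successively (adj (induce G U)) p \<longleftrightarrow> successively (adj G) p"
    by (intro successively_cong_set) (auto simp: adj_induce)
  then show ?thesis using True by (auto simp: is_path_def verts_induce)
qed (auto simp: is_path_def verts_induce)

text \<open>The path grows with the walk. When the next vertex already lies on it, the path is cut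
  there instead, which avoids repetitions.\<close>

lemma reach_path:
  assumes "reach G U u v" "U \<subseteq> verts G"
  shows "\<exists>p. is_path G p \<and> hd p = u \<and> last p = v \<and> set p \<subseteq> U"
proof -
  have "v \<in> {x. \<exists>p. is_path G p \<and> hd p = u \<and> last p = x \<and> set p \<subseteq> U}" (is "_ \<in> ?A")
  proof (rule reach_closed[OF assms(1)])
    show "u \<in> ?A" using reach_in(1)[OF assms(1)] assms(2)
      by (auto intro!: exI[of _ "[u]"] simp: is_path_def)
  next
    fix x y assume "x \<in> ?A" "x \<in> U" "y \<in> U" and a: "adj G x y"
    then obtain p where p: "is_path G p" "hd p = u" "last p = x" "set p \<subseteq> U" by blast
    show "y \<in> ?A"
    proof (cases "y \<in> set p")
      case True
      then obtain a b where ab: "p = a @ y # b" by (meson split_list)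
      have "is_path G (a @ [y])" using p(1) unfolding ab is_path_def
        by (auto simp: successively_append_iff successively_Cons)
      moreover have "hd (a @ [y]) = u" using p(2) ab by (cases a) auto
      ultimately show ?thesis using p(4) ab by (intro CollectI exI[of _ "a @ [y]"]) auto
    next
      case False
      have "is_path G (p @ [y])" using p False a \<open>y \<in> U\<close> assms(2)
        by (auto simp: is_path_def successively_append_iff)
      moreover have "hd (p @ [y]) = u" using p by (cases p) (auto simp: is_path_def)
      ultimately show ?thesis using p \<open>y \<in> U\<close> by (intro CollectI exI[of _ "p @ [y]"]) auto
    qed
  qed
  then show ?thesis by simp
qed

lemma path_reach_hd:
  assumes "successively (adj G) p" "p \<noteq> []" "x \<in> set p" "set p \<subseteq> U"
  shows "reach G U (hd p) x"
  using assms
proof (induction p arbitrary: x rule: rev_induct)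
  case (snoc a xs)
  show ?case
  proof (cases "xs = []")
    case True
    then show ?thesis using snoc by (auto intro: reach_refl)
  next
    case False
    have IH: "y \<in> set xs \<Longrightarrow> reach G U (hd xs) y" for y
      using snoc False by (auto simp: successively_append_iff)
    have "adj G (last xs) a" using snoc.prems False by (auto simp: successively_append_iff)
    then have "reach G U (hd xs) a"
      using reach_step[OF IH[of "last xs"]] False snoc.prems by auto
    then show ?thesis using IH False snoc.prems by auto
  qed
qed simp

lemma path_reach:
  assumes "is_path G p" "x \<in> set p" "y \<in> set p" "set p \<subseteq> U"
  shows "reach G U x y"
  using assms path_reach_hd[of G p] reach_trans reach_sym by (metis is_path_def)

lemma linked_iff_reach:
  assumes "U \<subseteq> verts G"
  shows "linked (induce G U) u v \<longleftrightarrow> reach G U u v"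
proof
  assume "linked (induce G U) u v"
  then obtain p where p: "is_path G p" "set p \<subseteq> U" "hd p = u" "last p = v"
    unfolding linked_def is_path_induce by blast
  then show "reach G U u v" using path_reach[OF p(1), of u v U] by (auto simp: is_path_def)
next
  assume "reach G U u v"
  then show "linked (induce G U) u v" using reach_path[of G U u v] assms
    unfolding linked_def is_path_induce by blast
qed

lemma comps_del_verts:
  "comps (del_verts G S) = component_of G (verts G - S) ` (verts G - S)"
  by (simp add: comps_def del_verts_simps component_of_def)
    (simp add: del_verts_def linked_iff_reach)

lemma connected_graph_induce:
  "U \<subseteq> verts G \<Longrightarrow> connected_graph (induce G U) \<longleftrightarrow> conn_set G U"
  by (simp add: connected_graph_def conn_set_def linked_iff_reach verts_induce Int_absorb1)

lemma simple_graph_induce: "simple_graph G \<Longrightarrow> simple_graph (induce G U)"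
  unfolding simple_graph_def induce_def by fastforce

lemma induce_subgraph: "simple_graph G \<Longrightarrow> is_subgraph (induce G U) G"
  by (auto simp: is_subgraph_def simple_graph_induce) (auto simp: induce_def)

text \<open>The path is cut at its first vertex in \<open>W\<close>.\<close>

lemma path_to_set:
  assumes "reach G U u w" "U \<subseteq> verts G" "w \<in> W"
  shows "\<exists>p. is_path G p \<and> hd p = u \<and> set p \<subseteq> U \<and> set p \<inter> W = {last p}"
proof -
  obtain p where p: "is_path G p" "hd p = u" "last p = w" "set p \<subseteq> U"
    using reach_path[OF assms(1,2)] by blast
  have "\<exists>x\<in>set p. x \<in> W" using p assms(3) by (metis is_path_def last_in_set)
  then obtain a x b where ab: "p = a @ x # b" "x \<in> W" "\<forall>y\<in>set a. y \<notin> W"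
    using split_list_first_prop[of p "\<lambda>x. x \<in> W"] by blast
  have "is_path G (a @ [x])" using p(1) unfolding ab is_path_def
    by (auto simp: successively_append_iff successively_Cons)
  moreover have "hd (a @ [x]) = u" using p(2) ab by (cases a) auto
  ultimately show ?thesis using p(4) ab by (intro exI[of _ "a @ [x]"]) auto
qed

locale sgraph =
  fixes G :: "'a ugraph"
  assumes simple: "simple_graph G"
begin

abbreviation "V \<equiv> verts G"

lemma adj_verts: "adj G u v \<Longrightarrow> u \<in> V" "adj G u v \<Longrightarrow> v \<in> V" "adj G u v \<Longrightarrow> u \<noteq> v"
  using simple unfolding simple_graph_def adj_def by (fastforce simp: doubleton_eq_iff)+

lemma nbhd_iff: "w \<in> nbhd G v \<longleftrightarrow> adj G v w"
  using adj_verts by (auto simp: nbhd_def)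

lemma component_closed:
  "x \<in> component_of G U v \<Longrightarrow> adj G x y \<Longrightarrow> y \<in> U \<Longrightarrow> y \<in> component_of G U v"
  unfolding component_of_def by (auto intro: reach_step)

text \<open>An outside neighbour of a component of \<open>U - F\<close> cannot lie in
  \<open>U - F\<close>, so it lies outside \<open>U\<close> or in \<open>F\<close>.\<close>

lemma outer_nbhd_component:
  "U \<subseteq> V \<Longrightarrow> outer_nbhd G (component_of G (U - F) v) \<subseteq> outer_nbhd G U \<union> F"
  using component_closed[of _ "U - F" v] component_of_subset[of G "U - F" v]
  by (auto simp: outer_nbhd_def)

section \<open>Rays and ends\<close>

lemma ray_avoids_finite:
  assumes "is_ray G R" "finite S"
  shows "\<exists>i\<ge>i0. \<forall>n\<ge>i. R n \<notin> S"
proof -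
  have "finite {n. R n \<in> S}"
    using finite_vimageI[OF assms(2)] assms(1) by (auto simp: is_ray_def vimage_def)
  then obtain N where "\<forall>n\<in>{n. R n \<in> S}. n \<le> N" by (meson finite_nat_set_iff_bounded_le)
  then show ?thesis by (intro exI[of _ "Suc N + i0"]) force
qed

lemma ray_reach:
  assumes "is_ray G R" "\<And>n. n \<ge> i \<Longrightarrow> R n \<in> U" "i \<le> n" "i \<le> m"
  shows "reach G U (R n) (R m)"
proof -
  have *: "reach G U (R i) (R n)" if "i \<le> n" for n
    using that
  proof (induction n rule: dec_induct)
    case base
    then show ?case using assms by (simp add: reach_refl)
  next
    case (step n)
    then show ?case using assms by (intro reach_step[OF step.IH]) (auto simp: is_ray_def)
  qed
  show ?thesis using *[of n] *[of m] assms reach_sym reach_trans by metis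
qed

text \<open>Replaces the separation of whole rays by a statement on tails. The obstacle is that
  deleting \<open>S\<close> may scatter an initial segment of a ray over several components, whereas
  \<open>separates_rays\<close> wants each remainder in a single one.\<close>

lemma ray_equiv_iff:
  assumes "is_ray G R" "is_ray G R'"
  shows "(R, R') \<in> ray_equiv G \<longleftrightarrow>
    (\<forall>S i j. finite S \<longrightarrow> (\<forall>n\<ge>i. R n \<notin> S) \<longrightarrow> (\<forall>n\<ge>j. R' n \<notin> S) \<longrightarrow> reach G (V - S) (R i) (R' j))"
    (is "_ \<longleftrightarrow> ?rhs")
proof
  assume eq: "(R, R') \<in> ray_equiv G"
  show ?rhs
  proof (intro allI impI, rule ccontr)
    fix S i j assume S: "finite S" and i: "\<forall>n\<ge>i. R n \<notin> S" and j: "\<forall>n\<ge>j. R' n \<notin> S"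
      and nr: "\<not> reach G (V - S) (R i) (R' j)"
    have RV: "R n \<in> V" "R' n \<in> V" for n using assms by (auto simp: is_ray_def)
    have r1: "reach G (V - S) (R i) (R n)" if "n \<ge> i" for n
      using that by (intro ray_reach[OF assms(1), of i]) (use RV i in auto)
    have r2: "reach G (V - S) (R' j) (R' n)" if "n \<ge> j" for n
      using that by (intro ray_reach[OF assms(2), of j]) (use RV j in auto)
    \<comment> \<open>The two tails lie in different components outside \<open>S\<close>, so they
      are disjoint.\<close>
    have disj: "R n \<noteq> R' l" if "n \<ge> i" "l \<ge> j" for n l
      using nr r1[OF that(1)] r2[OF that(2)] reach_trans[OF _ reach_sym] by fastforce
    obtain a where a: "a \<ge> i" "\<forall>n\<ge>a. R n \<notin> S \<union> R' ` {..<j}"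
      using ray_avoids_finite[OF assms(1), of "S \<union> R' ` {..<j}" i] S by auto
    obtain b where b: "b \<ge> j" "\<forall>n\<ge>b. R' n \<notin> S \<union> R ` {..<a}"
      using ray_avoids_finite[OF assms(2), of "S \<union> R ` {..<a}" j] S by auto
    \<comment> \<open>Deleting the initial segments as well leaves exactly one tail of each ray,
      hence a remainder within one component. The choice of \<open>a\<close> and \<open>b\<close>,
      together with \<open>disj\<close>, keeps these tails outside \<open>T\<close>.\<close>
    define T where "T = (S \<inter> V) \<union> R ` {..<a} \<union> R' ` {..<b}"
    have T: "finite T" "T \<subseteq> V" using S RV by (auto simp: T_def)
    have Ra: "R n \<notin> T" if "n \<ge> a" for n
    proof -
      have "R n \<noteq> R' l" if "l < b" for l
        using disj[of n l] a \<open>n \<ge> a\<close> by (cases "l < j") auto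
      moreover have "R n \<noteq> R l" if "l < a" for l
        using that \<open>n \<ge> a\<close> assms(1) unfolding is_ray_def by (metis injD leD)
      ultimately show ?thesis using a that by (auto simp: T_def)
    qed
    have Rb: "R' n \<notin> T" if "n \<ge> b" for n
    proof -
      have "R' n \<noteq> R' l" if "l < b" for l
        using that \<open>n \<ge> b\<close> assms(2) unfolding is_ray_def by (metis injD leD)
      then show ?thesis using b that by (auto simp: T_def)
    qed
    have Tsub: "V - T \<subseteq> V - S" by (auto simp: T_def)
    have "range R - T \<subseteq> component_of G (V - T) (R a)"
    proof
      fix x assume "x \<in> range R - T"
      then obtain n where n: "x = R n" "n \<ge> a" by (force simp: T_def)
      then show "x \<in> component_of G (V - T) (R a)"
        unfolding component_of_def mem_Collect_eq n(1)
        by (intro ray_reach[OF assms(1), of a]) (use RV Ra in auto)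
    qed
    moreover have "range R' - T \<subseteq> component_of G (V - T) (R' b)"
    proof
      fix x assume "x \<in> range R' - T"
      then obtain n where n: "x = R' n" "n \<ge> b" by (force simp: T_def)
      then show "x \<in> component_of G (V - T) (R' b)"
        unfolding component_of_def mem_Collect_eq n(1)
        by (intro ray_reach[OF assms(2), of b]) (use RV Rb in auto)
    qed
    moreover have "component_of G (V - T) (R a) \<noteq> component_of G (V - T) (R' b)"
    proof
      assume "component_of G (V - T) (R a) = component_of G (V - T) (R' b)"
      then have "reach G (V - T) (R a) (R' b)"
        using reach_refl[of "R' b" "V - T" G] RV Rb by (auto simp: component_of_def set_eq_iff)
      then have "reach G (V - S) (R a) (R' b)" using reach_mono[OF _ Tsub] by blast
      then have "reach G (V - S) (R i) (R' j)"
        using reach_trans[OF reach_trans[OF r1[OF a(1)]] reach_sym[OF r2[OF b(1)]]] by blast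
      then show False using nr by blast
    qed
    ultimately have "separates_rays G T R R'"
      unfolding separates_rays_def comps_del_verts using RV[of a] RV[of b] Ra[of a] Rb[of b]
      by (intro bexI[of _ "component_of G (V - T) (R a)"] bexI[of _ "component_of G (V - T) (R' b)"]) auto
    then show False using eq T by (auto simp: ray_equiv_def)
  qed
next
  assume r: ?rhs
  have False if fin: "finite S" and sep: "separates_rays G S R R'" for S
  proof -
    obtain C C' where C: "C \<in> comps (del_verts G S)" "C' \<in> comps (del_verts G S)" "C \<noteq> C'"
      "range R - S \<subseteq> C" "range R' - S \<subseteq> C'"
      using sep unfolding separates_rays_def by blast
    obtain i where i: "\<forall>n\<ge>i. R n \<notin> S" using ray_avoids_finite[OF assms(1) fin] by blast
    obtain j where j: "\<forall>n\<ge>j. R' n \<notin> S" using ray_avoids_finite[OF assms(2) fin] by blast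
    have "reach G (V - S) (R i) (R' j)" using r fin i j by blast
    then have "component_of G (V - S) (R i) = component_of G (V - S) (R' j)"
      by (rule component_of_eq)
    moreover obtain x y where "C = component_of G (V - S) x" "C' = component_of G (V - S) y"
      using C(1,2) unfolding comps_del_verts by blast
    moreover have "R i \<in> C" "R' j \<in> C'" using C i j by auto
    ultimately show False using C(3) component_of_eq[of G "V - S"] unfolding component_of_def
      by (metis mem_Collect_eq)
  qed
  then show "(R, R') \<in> ray_equiv G" using assms by (auto simp: ray_equiv_def)
qed

lemma equiv_ray_equiv: "equiv {R. is_ray G R} (ray_equiv G)"
proof (rule equivI)
  show "ray_equiv G \<subseteq> {R. is_ray G R} \<times> {R. is_ray G R}" by (auto simp: ray_equiv_def)
  show "refl_on {R. is_ray G R} (ray_equiv G)"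
  proof (rule refl_onI)
    fix R assume "R \<in> {R. is_ray G R}"
    then have R: "is_ray G R" by simp
    show "(R, R) \<in> ray_equiv G" unfolding ray_equiv_iff[OF R R]
    proof (intro allI impI)
      fix S i j assume "\<forall>n\<ge>i. R n \<notin> S" "\<forall>n\<ge>j. R n \<notin> S"
      then show "reach G (V - S) (R i) (R j)"
        using R by (intro ray_reach[OF R, of "min i j"]) (auto simp: is_ray_def min_def split: if_splits)
    qed
  qed
  show "sym (ray_equiv G)"
  proof (rule symI)
    fix R R' assume a: "(R, R') \<in> ray_equiv G"
    then have "is_ray G R" "is_ray G R'" by (auto simp: ray_equiv_def)
    then show "(R', R) \<in> ray_equiv G" using a ray_equiv_iff reach_sym by metis
  qed
  show "trans (ray_equiv G)"
  proof (rule transI)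
    fix R R' R'' assume a: "(R, R') \<in> ray_equiv G" and b: "(R', R'') \<in> ray_equiv G"
    then have r: "is_ray G R" "is_ray G R'" "is_ray G R''" by (auto simp: ray_equiv_def)
    show "(R, R'') \<in> ray_equiv G"
      unfolding ray_equiv_iff[OF r(1,3)]
    proof (intro allI impI)
      fix S i j assume S: "finite S" and i: "\<forall>n\<ge>i. R n \<notin> S" and j: "\<forall>n\<ge>j. R'' n \<notin> S"
      obtain l where l: "\<forall>n\<ge>l. R' n \<notin> S" using ray_avoids_finite[OF r(2) S] by blast
      show "reach G (V - S) (R i) (R'' j)"
        using a b unfolding ray_equiv_iff[OF r(1,2)] ray_equiv_iff[OF r(2,3)]
        using S i j l reach_trans by metis
    qed
  qed
qed

lemma end_ray: "\<omega> \<in> graph_ends G \<Longrightarrow> R \<in> \<omega> \<Longrightarrow> is_ray G R"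
  unfolding graph_ends_def quotient_def ray_equiv_def by auto

lemma end_equiv:
  assumes "\<omega> \<in> graph_ends G" "R \<in> \<omega>"
  shows "R' \<in> \<omega> \<longleftrightarrow> (R, R') \<in> ray_equiv G"
  using assms in_quotient_imp_closed[OF equiv_ray_equiv, of \<omega> R R']
    in_quotient_imp_in_rel[OF equiv_ray_equiv, of \<omega> R R']
  unfolding graph_ends_def by blast

lemma end_of_ray:
  assumes "is_ray G R" shows "ray_equiv G `` {R} \<in> graph_ends G" "R \<in> ray_equiv G `` {R}"
  using assms equiv_class_self[OF equiv_ray_equiv, of R]
    quotientI[of R "{R. is_ray G R}" "ray_equiv G"]
  unfolding graph_ends_def by simp_all

lemma end_eq_class:
  "\<omega> \<in> graph_ends G \<Longrightarrow> R \<in> \<omega> \<Longrightarrow> \<omega> = ray_equiv G `` {R}"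
  using end_equiv by blast

section \<open>Passing to tails within an end\<close>

lemma ray_tail: "is_ray G R \<Longrightarrow> is_ray G (\<lambda>n. R (n + i))"
  unfolding is_ray_def
  by (intro conjI injI allI) (auto simp: inj_eq image_subset_iff)

lemma ray_equiv_tail:
  assumes "is_ray G R" shows "(R, \<lambda>n. R (n + i)) \<in> ray_equiv G"
  unfolding ray_equiv_iff[OF assms ray_tail[OF assms]]
proof (intro allI impI)
  fix S a b assume a: "\<forall>n\<ge>a. R n \<notin> S" and b: "\<forall>n\<ge>b. R (n + i) \<notin> S"
  have b': "R n \<notin> S" if "n \<ge> b + i" for n
    using b[rule_format, of "n - i"] that by simp
  have RV: "R n \<in> V" for n using assms by (auto simp: is_ray_def)
  show "reach G (V - S) (R a) (R (b + i))"
  proof (rule ray_reach[OF assms, of "min a (b + i)"])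
    show "R n \<in> V - S" if "n \<ge> min a (b + i)" for n
      using a b'[of n] RV[of n] that by (cases "n \<ge> a") auto
  qed auto
qed

lemma end_tail:
  assumes "\<omega> \<in> graph_ends G" "R \<in> \<omega>" shows "(\<lambda>n. R (n + i)) \<in> \<omega>"
  using end_equiv[OF assms] ray_equiv_tail[OF end_ray[OF assms]] by simp

lemma end_reach:
  assumes "\<omega> \<in> graph_ends G" "R \<in> \<omega>" "R' \<in> \<omega>" "finite S"
    and "\<And>n. n \<ge> i \<Longrightarrow> R n \<notin> S" "\<And>n. n \<ge> j \<Longrightarrow> R' n \<notin> S"
  shows "reach G (V - S) (R i) (R' j)"
proof -
  have "(R, R') \<in> ray_equiv G" using end_equiv[OF assms(1,2)] assms(3) by simp
  then show ?thesis
    unfolding ray_equiv_iff[OF end_ray[OF assms(1,2)] end_ray[OF assms(1,3)]]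
    using assms(4-6) by blast
qed

end

section \<open>Infinitely linked vertices\<close>

lemma is_path_edges:
  assumes "simple_graph G" "is_path G p"
  shows "path_edges p \<subseteq> edges G" "e \<in> path_edges p \<Longrightarrow> \<exists>u\<in>set p. \<exists>v\<in>set p. u \<noteq> v \<and> e = {u, v}"
proof -
  have *: "adj G (p ! i) (p ! Suc i)" if "Suc i < length p" for i
    using assms(2) that by (auto simp: is_path_def successively_conv_nth)
  then show "path_edges p \<subseteq> edges G" by (auto simp: path_edges_def adj_def)
  assume "e \<in> path_edges p"
  then obtain i where i: "e = {p ! i, p ! Suc i}" "Suc i < length p" by (auto simp: path_edges_def)
  moreover have "p ! i \<noteq> p ! Suc i" using i(2) assms(2) nth_eq_iff_index_eq[of p i "Suc i"]
    by (auto simp: is_path_def)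
  ultimately show "\<exists>u\<in>set p. \<exists>v\<in>set p. u \<noteq> v \<and> e = {u, v}"
    by (metis Suc_lessD nth_mem)
qed

context sgraph
begin

text \<open>No finite set of other vertices separates \<open>u\<close> from \<open>v\<close>.
  Adjacent vertices satisfy this trivially; this is harmless, since a subdivision takes only one
  path per pair.\<close>

definition inf_linked :: "'a \<Rightarrow> 'a \<Rightarrow> bool" where
  "inf_linked u v \<longleftrightarrow> (\<forall>F. finite F \<longrightarrow> u \<notin> F \<longrightarrow> v \<notin> F \<longrightarrow> reach G (V - F) u v)"

text \<open>Greedy choice: each new path avoids the finite set of all branch vertices and earlier
  paths, except for its own two ends.\<close>

lemma linking_paths:
  fixes \<phi> :: "nat \<Rightarrow> 'a"
  assumes "finite E" "\<And>e. e \<in> E \<Longrightarrow> \<exists>i j. i < k \<and> j < k \<and> i \<noteq> j \<and> e = {i, j}"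
    and inj: "inj_on \<phi> {..<k}"
    and link: "\<And>i j. i < k \<Longrightarrow> j < k \<Longrightarrow> i \<noteq> j \<Longrightarrow> inf_linked (\<phi> i) (\<phi> j)"
  shows "\<exists>P. (\<forall>e\<in>E. is_path G (P e) \<and> {hd (P e), last (P e)} = \<phi> ` e) \<and>
        (\<forall>e\<in>E. inner_vertices (P e) \<inter> \<phi> ` {..<k} = {}) \<and>
        (\<forall>e\<in>E. \<forall>f\<in>E. e \<noteq> f \<longrightarrow> inner_vertices (P e) \<inter> set (P f) = {})"
  using assms(1,2)
proof (induction E rule: finite_induct)
  case (insert e E)
  then obtain P where P: "\<forall>e\<in>E. is_path G (P e) \<and> {hd (P e), last (P e)} = \<phi> ` e"
    "\<forall>e\<in>E. inner_vertices (P e) \<inter> \<phi> ` {..<k} = {}"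
    "\<forall>e\<in>E. \<forall>f\<in>E. e \<noteq> f \<longrightarrow> inner_vertices (P e) \<inter> set (P f) = {}" by blast
  obtain i j where ij: "i < k" "j < k" "i \<noteq> j" "e = {i, j}" using insert.prems by blast
  define F where "F = (\<phi> ` {..<k} \<union> (\<Union>f\<in>E. set (P f))) - {\<phi> i, \<phi> j}"
  have "finite F" using insert.hyps by (auto simp: F_def)
  then have linked: "reach G (V - F) (\<phi> i) (\<phi> j)"
    using link[OF ij(1-3)] unfolding inf_linked_def by (auto simp: F_def)
  then obtain p where p: "is_path G p" "hd p = \<phi> i" "last p = \<phi> j" "set p \<subseteq> V - F"
    using reach_path[OF linked] by auto
  have inner: "inner_vertices p = set p - {\<phi> i, \<phi> j}" using p by (simp add: inner_vertices_def)
  have new: "inner_vertices p \<inter> \<phi> ` {..<k} = {}" "\<And>f. f \<in> E \<Longrightarrow> inner_vertices p \<inter> set (P f) = {}"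
    using p(4) unfolding inner F_def by auto
  \<comment> \<open>The new path can meet an older one in an inner vertex of the latter neither at
    its ends, which are branch vertices, nor in its own inner vertices.\<close>
  have old: "inner_vertices (P f) \<inter> set p = {}" if "f \<in> E" for f
  proof -
    have "\<phi> i \<notin> inner_vertices (P f)" "\<phi> j \<notin> inner_vertices (P f)" using P(2) that ij by auto
    moreover have "inner_vertices (P f) \<subseteq> set (P f)" by (auto simp: inner_vertices_def)
    ultimately show ?thesis using new(2)[OF that] unfolding inner by blast
  qed
  have e: "{hd p, last p} = \<phi> ` e" using p ij by auto
  have Pe: "f \<in> E \<Longrightarrow> (P(e := p)) f = P f" for f using insert.hyps by auto
  show ?case
  proof (intro exI[of _ "P(e := p)"] conjI ballI impI)
    fix f assume f: "f \<in> insert e E"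
    show "is_path G ((P(e := p)) f)" "{hd ((P(e := p)) f), last ((P(e := p)) f)} = \<phi> ` f"
      using P(1) p(1) e f by (cases "f = e"; simp)+
    show "inner_vertices ((P(e := p)) f) \<inter> \<phi> ` {..<k} = {}"
      using P(2) new(1) f by (cases "f = e"; simp)
    fix g assume g: "g \<in> insert e E" "f \<noteq> g"
    consider "f = e" "g \<in> E" | "g = e" "f \<in> E" | "f \<in> E" "g \<in> E" using f g by blast
    then show "inner_vertices ((P(e := p)) f) \<inter> set ((P(e := p)) g) = {}"
    proof cases
      case 1
      then show ?thesis using new(2)[of g] Pe[of g] by simp
    next
      case 2
      then show ?thesis using old[of f] Pe[of f] by simp
    next
      case 3
      then show ?thesis using P(3) g(2) Pe[of f] Pe[of g] by simp
    qed
  qed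
qed simp

text \<open>The size condition is a negated conjunction so that it also covers infinite
  \<open>U\<close>, for which \<open>card U\<close> is 0.\<close>

lemma complete_top_minor:
  assumes U: "U \<subseteq> V" "\<not> (finite U \<and> card U < k)"
    and link: "\<And>u v. u \<in> U \<Longrightarrow> v \<in> U \<Longrightarrow> u \<noteq> v \<Longrightarrow> inf_linked u v"
  shows "top_minor (complete_graph k) G"
proof -
  obtain W where W: "W \<subseteq> U" "finite W" "card W = k"
    using U(2) by (metis infinite_arbitrarily_large not_less obtain_subset_with_card_n)
  obtain \<phi> :: "nat \<Rightarrow> 'a" where \<phi>: "bij_betw \<phi> {..<k} W"
    using ex_bij_betw_nat_finite[OF W(2)] W(3) by (auto simp: atLeast0LessThan)
  let ?E = "edges (complete_graph k)"
  have E: "?E = {{i, j} |i j. i < k \<and> j < k \<and> i \<noteq> j}" "verts (complete_graph k) = {..<k}"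
    by (simp_all add: complete_graph_def)
  have "?E \<subseteq> Pow {..<k}" unfolding E by auto
  then have finE: "finite ?E" using finite_subset by blast
  have inj: "inj_on \<phi> {..<k}" and im: "\<phi> ` {..<k} = W" using \<phi> by (auto simp: bij_betw_def)
  obtain P where P: "\<forall>e\<in>?E. is_path G (P e) \<and> {hd (P e), last (P e)} = \<phi> ` e"
    "\<forall>e\<in>?E. inner_vertices (P e) \<inter> \<phi> ` {..<k} = {}"
    "\<forall>e\<in>?E. \<forall>f\<in>?E. e \<noteq> f \<longrightarrow> inner_vertices (P e) \<inter> set (P f) = {}"
  proof -
    have l: "inf_linked (\<phi> i) (\<phi> j)" if "i < k" "j < k" "i \<noteq> j" for i j
      using link[of "\<phi> i" "\<phi> j"] that inj im W(1) by (auto simp: inj_on_def)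
    have e: "\<exists>i j. i < k \<and> j < k \<and> i \<noteq> j \<and> e = {i, j}" if "e \<in> ?E" for e
      using that unfolding E by blast
    show thesis
      by (rule exE[OF linking_paths[OF finE e inj l]], assumption+, elim conjE, rule that)
  qed
  define T where "T = \<lparr>verts = \<phi> ` {..<k} \<union> (\<Union>e\<in>?E. set (P e)), edges = (\<Union>e\<in>?E. path_edges (P e))\<rparr>"
  have PV: "set (P e) \<subseteq> V" if "e \<in> ?E" for e using P(1) that by (auto simp: is_path_def)
  have "is_subgraph T G"
  proof -
    have "\<exists>u\<in>verts T. \<exists>v\<in>verts T. u \<noteq> v \<and> f = {u, v}" if "f \<in> edges T" for f
    proof -
      obtain e where e: "e \<in> ?E" "f \<in> path_edges (P e)" using \<open>f \<in> edges T\<close> by (auto simp: T_def)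
      obtain u v where "u \<in> set (P e)" "v \<in> set (P e)" "u \<noteq> v" "f = {u, v}"
        using is_path_edges(2)[OF simple _ e(2)] P(1) e(1) by blast
      then show ?thesis using e(1) by (auto simp: T_def)
    qed
    moreover have "verts T \<subseteq> V" using PV im W(1) U(1) by (auto simp: T_def)
    moreover have "edges T \<subseteq> edges G" using is_path_edges(1)[OF simple] P(1) by (fastforce simp: T_def)
    ultimately show ?thesis by (auto simp: is_subgraph_def simple_graph_def)
  qed
  moreover have "is_path T (P e)" if "e \<in> ?E" for e
  proof -
    have "is_path G (P e)" using P(1) that by blast
    moreover have "adj T (P e ! i) (P e ! Suc i)" if "Suc i < length (P e)" for i
      using that \<open>e \<in> ?E\<close> by (auto simp: T_def adj_def path_edges_def)
    ultimately show ?thesis using that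
      unfolding is_path_def successively_conv_nth by (auto simp: T_def)
  qed
  then have "is_subdivision (complete_graph k) T"
    unfolding is_subdivision_def using P inj unfolding E(2)[symmetric]
    by (intro exI[of _ \<phi>] exI[of _ P]) (auto simp: T_def E(2))
  ultimately show ?thesis unfolding top_minor_def by blast
qed

section \<open>Dominating vertices\<close>

text \<open>An infinite fan is built path by path: the vertices other than \<open>v\<close> on the
  paths chosen so far form a finite set, which the next path avoids.\<close>

lemma dominates_rayI:
  assumes v: "v \<notin> range R"
    and link: "\<And>F. finite F \<Longrightarrow> v \<notin> F \<Longrightarrow> \<exists>i. reach G (V - F) v (R i)"
  shows "dominates_ray G v R"
proof -
  have ex: "\<exists>p. vertex_set_path G v (range R) p \<and> set p \<inter> F = {}" if F: "finite F" "v \<notin> F" for F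
  proof -
    obtain i where "reach G (V - F) v (R i)" using link[OF F] by blast
    from path_to_set[OF this, of "range R"] show ?thesis by (auto simp: vertex_set_path_def)
  qed
  \<comment> \<open>The state pairs a finite forbidden set with a path avoiding it. The next
    forbidden set absorbs this path except for \<open>v\<close>.\<close>
  have "\<exists>f. \<forall>n. (finite (fst (f n)) \<and> v \<notin> fst (f n) \<and>
        vertex_set_path G v (range R) (snd (f n)) \<and> set (snd (f n)) \<inter> fst (f n) = {}) \<and>
      fst (f (Suc n)) = fst (f n) \<union> (set (snd (f n)) - {v})"
  proof (rule dependent_nat_choice)
    show "\<exists>x. finite (fst x) \<and> v \<notin> fst x \<and> vertex_set_path G v (range R) (snd x) \<and> set (snd x) \<inter> fst x = {}"
      using ex[of "{}"] by auto
  next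
    fix x :: "'a set \<times> 'a list" and n :: nat
    assume "finite (fst x) \<and> v \<notin> fst x \<and> vertex_set_path G v (range R) (snd x) \<and> set (snd x) \<inter> fst x = {}"
    then obtain p where "vertex_set_path G v (range R) p"
        "set p \<inter> (fst x \<union> (set (snd x) - {v})) = {}"
      using ex[of "fst x \<union> (set (snd x) - {v})"] by auto
    with \<open>finite (fst x) \<and> _\<close> show "\<exists>y. (finite (fst y) \<and> v \<notin> fst y \<and>
        vertex_set_path G v (range R) (snd y) \<and> set (snd y) \<inter> fst y = {}) \<and>
        fst y = fst x \<union> (set (snd x) - {v})"
      by (intro exI[of _ "(fst x \<union> (set (snd x) - {v}), p)"]) simp
  qed
  then obtain f where f: "\<And>n. vertex_set_path G v (range R) (snd (f n))"
    "\<And>n. set (snd (f n)) \<inter> fst (f n) = {}"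
    "\<And>n. fst (f (Suc n)) = fst (f n) \<union> (set (snd (f n)) - {v})" by blast
  have acc: "set (snd (f i)) - {v} \<subseteq> fst (f j)" if "i < j" for i j
    using that by (induction j) (auto simp: f(3) less_Suc_eq)
  have vin: "v \<in> set (snd (f n))" for n
    using f(1)[of n] by (auto simp: vertex_set_path_def is_path_def)
  have lt: "set (snd (f i)) \<inter> set (snd (f j)) = {v}" if "i < j" for i j
    using acc[OF that] f(2)[of j] vin by blast
  then have disj: "set (snd (f i)) \<inter> set (snd (f j)) = {v}" if "i \<noteq> j" for i j
    using that by (metis Int_commute linorder_neqE_nat)
  \<comment> \<open>A repeated path would consist of \<open>v\<close> alone, but its last vertex
    lies on the ray and \<open>v\<close> does not.\<close>
  have "inj (\<lambda>n. snd (f n))"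
  proof (rule injI, rule ccontr)
    fix i j assume "snd (f i) = snd (f j)" "i \<noteq> j"
    then have "set (snd (f i)) = {v}" using disj[of i j] by simp
    then show False using f(1)[of i] v by (auto simp: vertex_set_path_def)
  qed
  then have "infinite (range (\<lambda>n. snd (f n)))" by (rule range_inj_infinite)
  then show ?thesis unfolding dominates_ray_def
  proof (intro exI[of _ "range (\<lambda>n. snd (f n))"] conjI ballI impI)
    fix p q assume "p \<in> range (\<lambda>n. snd (f n))" "q \<in> range (\<lambda>n. snd (f n))" "p \<noteq> q"
    then obtain i j where "p = snd (f i)" "q = snd (f j)" "i \<noteq> j" by blast
    then show "set p \<inter> set q = {v}" using disj by simp
  qed (use f(1) in auto)
qed

text \<open>The paths share only \<open>v\<close>, so a finite set without \<open>v\<close> meets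
  finitely many of them and misses some path of the fan.\<close>

lemma dominates_rayD:
  assumes d: "dominates_ray G v R" and F: "finite F" "v \<notin> F" and R: "is_ray G R"
  shows "\<exists>i\<ge>i0. reach G (V - F) v (R i)"
proof -
  obtain \<P> where P: "infinite \<P>" "\<And>p. p \<in> \<P> \<Longrightarrow> vertex_set_path G v (range R) p"
    "\<And>p q. p \<in> \<P> \<Longrightarrow> q \<in> \<P> \<Longrightarrow> p \<noteq> q \<Longrightarrow> set p \<inter> set q = {v}"
    using d unfolding dominates_ray_def by metis
  \<comment> \<open>If \<open>v\<close> were on the ray, every path of the fan would stop at once
    and equal \<open>[v]\<close>.\<close>
  have vR: "v \<notin> range R"
  proof
    assume v: "v \<in> range R"
    have "p = [v]" if "p \<in> \<P>" for p
    proof -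
      have p: "is_path G p" "hd p = v" "set p \<inter> range R = {last p}"
        using P(2)[OF that] by (auto simp: vertex_set_path_def)
      then have "hd p = last p" using v by (metis Int_iff hd_in_set is_path_def singletonD)
      then show ?thesis using p by (cases p) (auto simp: is_path_def split: if_splits)
    qed
    then have "\<P> \<subseteq> {[v]}" by blast
    then show False using P(1) finite_subset by blast
  qed
  \<comment> \<open>Forbidding the first \<open>i0\<close> vertices of the ray forces the path to
    end at an index of at least \<open>i0\<close>.\<close>
  define F' where "F' = F \<union> R ` {..<i0}"
  have F': "finite F'" "v \<notin> F'" using F vR by (auto simp: F'_def)
  have "\<exists>p\<in>\<P>. set p \<inter> F' = {}"
  proof (rule ccontr)
    assume "\<not> ?thesis"
    then have "\<forall>p\<in>\<P>. \<exists>x. x \<in> F' \<and> x \<in> set p" by blast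
    then obtain g where g: "\<forall>p\<in>\<P>. g p \<in> F' \<and> g p \<in> set p" by metis
    have "inj_on g \<P>"
    proof (rule inj_onI, rule ccontr)
      fix p q assume "p \<in> \<P>" "q \<in> \<P>" "g p = g q" "p \<noteq> q"
      then have "g p \<in> set p \<inter> set q" using g by auto
      then show False using P(3) F'(2) g \<open>p \<in> \<P>\<close> \<open>q \<in> \<P>\<close> \<open>p \<noteq> q\<close> by fastforce
    qed
    then show False using P(1) F'(1) g by (metis finite_imageD finite_subset image_subsetI)
  qed
  then obtain p where p: "p \<in> \<P>" "set p \<inter> F' = {}" by blast
  have pp: "is_path G p" "hd p = v" "set p \<inter> range R = {last p}"
    using P(2)[OF p(1)] by (auto simp: vertex_set_path_def)
  obtain i where i: "last p = R i" using pp(3) by auto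
  have "i \<ge> i0" using p(2) pp i unfolding F'_def
    by (metis IntI UnI2 empty_iff imageI is_path_def last_in_set lessThan_iff not_less)
  moreover have "reach G (V - F) v (R i)"
  proof (rule path_reach[OF pp(1)])
    show "v \<in> set p" "R i \<in> set p"
      using pp(1,2) last_in_set[of p] i by (auto simp: is_path_def)
    show "set p \<subseteq> V - F" using pp(1) p(2) by (auto simp: is_path_def F'_def)
  qed
  ultimately show ?thesis by blast
qed

text \<open>Each of the two vertices reaches a late vertex of some ray of the end while avoiding
  \<open>F\<close>, and the tails of the two rays are joined outside \<open>F\<close>.\<close>

lemma Dom_inf_linked:
  assumes \<omega>: "\<omega> \<in> graph_ends G" and u: "u \<in> Dom G \<omega>" and v: "v \<in> Dom G \<omega>"
  shows "inf_linked u v"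
  unfolding inf_linked_def
proof (intro allI impI)
  fix F assume F: "finite F" "u \<notin> F" "v \<notin> F"
  obtain R R' where R: "R \<in> \<omega>" "dominates_ray G u R" "R' \<in> \<omega>" "dominates_ray G v R'"
    using u v by (auto simp: Dom_def)
  have ray: "is_ray G R" "is_ray G R'" using R \<omega> end_ray by auto
  obtain i j where i: "\<forall>n\<ge>i. R n \<notin> F" and j: "\<forall>n\<ge>j. R' n \<notin> F"
    using ray_avoids_finite[OF ray(1) F(1)] ray_avoids_finite[OF ray(2) F(1)] by blast
  obtain a where a: "a \<ge> i" "reach G (V - F) u (R a)"
    using dominates_rayD[OF R(2) F(1,2) ray(1)] by blast
  obtain b where b: "b \<ge> j" "reach G (V - F) v (R' b)"
    using dominates_rayD[OF R(4) F(1,3) ray(2)] by blast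
  have "reach G (V - F) (R a) (R' b)"
    by (rule end_reach[OF \<omega> R(1,3) F(1)]) (use i j a b in auto)
  then show "reach G (V - F) u v" using a(2) b(2) reach_trans reach_sym by metis
qed

end

section \<open>Infinite connected sets with finite neighbourhood\<close>

context sgraph
begin

definition big_region :: "'a set \<Rightarrow> bool" where
  "big_region C \<longleftrightarrow> C \<subseteq> V \<and> infinite C \<and> conn_set G C \<and> finite (outer_nbhd G C)"

lemma big_region_component:
  assumes "C \<subseteq> V" "finite (outer_nbhd G C)" "finite F" "v \<in> C - F" "infinite (component_of G (C - F) v)"
  shows "big_region (component_of G (C - F) v)"
proof -
  have "outer_nbhd G (component_of G (C - F) v) \<subseteq> outer_nbhd G C \<union> F"
    using outer_nbhd_component assms(1) by blast
  then have "finite (outer_nbhd G (component_of G (C - F) v))"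
    using assms(2,3) by (meson finite_UnI finite_subset)
  then show ?thesis unfolding big_region_def
    using assms component_of_subset[of G "C - F" v] conn_component[OF assms(4)] by blast
qed

text \<open>Every exit from \<open>C - F\<close> passes through the outer neighbourhood of
  \<open>C\<close> or through \<open>F\<close>.\<close>

lemma component_outer:
  assumes "x \<in> component_of G (C - F) v" "reach G (V - (outer_nbhd G C \<union> F)) x y"
  shows "y \<in> component_of G (C - F) v"
proof (rule reach_closed[OF assms(2,1)])
  fix a b assume a: "a \<in> component_of G (C - F) v" and b: "b \<in> V - (outer_nbhd G C \<union> F)" "adj G a b"
  have "a \<in> C" using a component_of_subset[of G "C - F" v] by blast
  then have "b \<in> C" using b unfolding outer_nbhd_def using adj_sym by fast
  then show "b \<in> component_of G (C - F) v" using component_closed[OF a b(2)] b by blast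
qed

text \<open>Two rays of the same end cannot be separated by the finite set consisting of
  \<open>F\<close> and the outer neighbourhood of \<open>C\<close>.\<close>

lemma two_ends_rays:
  assumes \<omega>: "\<omega> \<in> graph_ends G" "R \<in> \<omega>" "R' \<in> \<omega>"
    and fin: "finite (outer_nbhd G C)" "finite F"
    and R: "range R \<subseteq> component_of G (C - F) v" "range R' \<subseteq> component_of G (C - F) w"
  shows "component_of G (C - F) v = component_of G (C - F) w"
proof -
  have *: "x \<notin> outer_nbhd G C \<union> F" if "x \<in> component_of G (C - F) z" for x z
    using that component_of_subset[of G "C - F" z] by (auto simp: outer_nbhd_def)
  have "reach G (V - (outer_nbhd G C \<union> F)) (R 0) (R' 0)"
    by (rule end_reach[OF \<omega>]) (use fin R * in auto)
  then have "R' 0 \<in> component_of G (C - F) v" using component_outer R(1) by blast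
  moreover have "R' 0 \<in> component_of G (C - F) w" using R(2) by blast
  ultimately show ?thesis using component_of_eq unfolding component_of_def by (metis mem_Collect_eq)
qed

end

text \<open>The situation after negating the conclusion. \<open>sparse\<close> is the bound on the
  average degree of finite induced subgraphs with the denominator cleared; \<open>degree\<close> is
  restricted to finite neighbourhoods, because \<open>card\<close> of an infinite set is 0.\<close>

locale sparse_graph = sgraph +
  fixes k :: nat and m :: rat
  assumes no_minor: "\<not> top_minor (complete_graph k) G"
    and sparse: "\<And>A. finite A \<Longrightarrow> A \<noteq> {} \<Longrightarrow> A \<subseteq> V \<Longrightarrow>
      (\<Sum>v\<in>A. of_nat (card (nbhd G v \<inter> A))) \<le> (m - of_nat k + 1) * of_nat (card A)"
    and degree: "\<And>v. v \<in> V \<Longrightarrow> finite (nbhd G v) \<Longrightarrow> m < of_nat (card (nbhd G v))"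
begin

lemma inf_linked_few:
  "U \<subseteq> V \<Longrightarrow> (\<And>u v. u \<in> U \<Longrightarrow> v \<in> U \<Longrightarrow> u \<noteq> v \<Longrightarrow> inf_linked u v) \<Longrightarrow> finite U \<and> card U < k"
  using complete_top_minor no_minor by blast

text \<open>With at most \<open>k - 1\<close> neighbours outside, every vertex of \<open>D\<close>
  would keep more than \<open>m - k + 1\<close> neighbours inside \<open>D\<close>, contradicting
  \<open>sparse\<close>.\<close>

lemma finite_set_many_nbrs:
  assumes D: "finite D" "D \<noteq> {}" "D \<subseteq> V" and N: "finite (outer_nbhd G D)" shows "card (outer_nbhd G D) \<ge> k"
proof (rule ccontr)
  assume "\<not> ?thesis"
  then have k: "of_nat (card (outer_nbhd G D)) \<le> (of_nat k - 1 :: rat)"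
    by (metis Suc_leI add_diff_cancel_right' add.commute not_le of_nat_Suc of_nat_le_iff diff_mono order_refl)
  have "(m - of_nat k + 1) < of_nat (card (nbhd G v \<inter> D))" if v: "v \<in> D" for v
  proof -
    have sub: "nbhd G v \<subseteq> (nbhd G v \<inter> D) \<union> outer_nbhd G D"
      using v adj_sym by (fastforce simp: nbhd_def outer_nbhd_def)
    then have fin: "finite (nbhd G v)" using D N finite_subset by blast
    have "card (nbhd G v) \<le> card (nbhd G v \<inter> D) + card (outer_nbhd G D)"
      using card_mono[OF _ sub] card_Un_le fin N by (meson finite_Int finite_UnI order_trans)
    then have "(of_nat (card (nbhd G v)) :: rat) \<le> of_nat (card (nbhd G v \<inter> D)) + of_nat (card (outer_nbhd G D))"
      by (metis of_nat_add of_nat_le_iff)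
    then show ?thesis using degree[OF _ fin] D(3) v k by fastforce
  qed
  then have "(\<Sum>v\<in>D. (m - of_nat k + 1)) < (\<Sum>v\<in>D. of_nat (card (nbhd G v \<inter> D)))"
    using D by (intro sum_strict_mono) auto
  then show False using sparse[OF D] by (simp add: mult.commute)
qed

text \<open>Infinitely many finite components would include infinitely many with the same
  neighbourhood, whose vertices are then infinitely linked, so that it has fewer than \<open>k\<close> elements.\<close>

lemma finite_components:
  assumes C: "C \<subseteq> V" "finite (outer_nbhd G C)" and F: "finite F"
  shows "finite {v \<in> C - F. finite (component_of G (C - F) v)}"
proof (rule ccontr)
  define Q where "Q = {v \<in> C - F. finite (component_of G (C - F) v)}"
  define \<D> where "\<D> = component_of G (C - F) ` Q"
  assume "infinite {v \<in> C - F. finite (component_of G (C - F) v)}"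
  have self: "x \<in> component_of G (C - F) x" if "x \<in> C - F" for x
    using reach_refl[OF that] by (simp add: component_of_def)
  from \<open>infinite {v \<in> _. _}\<close> have "infinite Q" by (simp add: Q_def)
  moreover have "Q \<subseteq> \<Union>\<D>" using self by (auto simp: \<D>_def Q_def)
  moreover have finD: "finite D" if "D \<in> \<D>" for D using that by (auto simp: \<D>_def Q_def)
  ultimately have inf: "infinite \<D>" by (meson finite_Union finite_subset)
  have Dsub: "D \<subseteq> C - F" if "D \<in> \<D>" for D
    using that component_of_subset[of G "C - F"] by (auto simp: \<D>_def)
  have nb: "outer_nbhd G D \<subseteq> outer_nbhd G C \<union> F" if "D \<in> \<D>" for D
    using that outer_nbhd_component C(1) by (auto simp: \<D>_def)
  have "finite (outer_nbhd G ` \<D>)"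
    by (rule finite_subset[of _ "Pow (outer_nbhd G C \<union> F)"]) (use nb C F in auto)
  then obtain D0 where D0: "D0 \<in> \<D>" and infD: "infinite {D \<in> \<D>. outer_nbhd G D = outer_nbhd G D0}"
    using pigeonhole_infinite[OF inf] by blast
  have link: "inf_linked u v" if "u \<in> outer_nbhd G D0" "v \<in> outer_nbhd G D0" for u v
    unfolding inf_linked_def
  proof (intro allI impI)
    fix F' assume F': "finite F'" "u \<notin> F'" "v \<notin> F'"
    \<comment> \<open>Distinct components are disjoint, so the finite set \<open>F'\<close> meets
      only finitely many of the infinitely many candidates.\<close>
    have "\<exists>D\<in>{D \<in> \<D>. outer_nbhd G D = outer_nbhd G D0}. D \<inter> F' = {}"
    proof (rule ccontr)
      assume no: "\<not> ?thesis"
      have "{D \<in> \<D>. outer_nbhd G D = outer_nbhd G D0} \<subseteq> component_of G (C - F) ` F'"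
      proof
        fix D assume D: "D \<in> {D \<in> \<D>. outer_nbhd G D = outer_nbhd G D0}"
        then obtain x where x: "x \<in> D" "x \<in> F'" using no by blast
        obtain w where "D = component_of G (C - F) w" using D by (auto simp: \<D>_def)
        then have "D = component_of G (C - F) x"
          using x(1) component_of_eq[of G "C - F" w x] by (simp add: component_of_def)
        then show "D \<in> component_of G (C - F) ` F'" using x(2) by blast
      qed
      then show False using infD F'(1) finite_subset by blast
    qed
    then obtain D where D: "D \<in> \<D>" "outer_nbhd G D = outer_nbhd G D0" "D \<inter> F' = {}" by blast
    have nbr: "\<exists>x\<in>D. adj G z x" if "z \<in> outer_nbhd G D" for z
      using that adj_sym[of G _ z] by (auto simp: outer_nbhd_def)
    obtain x y where x: "x \<in> D" "adj G u x" and y: "y \<in> D" "adj G v y"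
      using nbr[of u] nbr[of v] \<open>u \<in> outer_nbhd G D0\<close> \<open>v \<in> outer_nbhd G D0\<close> D(2) by auto
    obtain w where w: "w \<in> C - F" "D = component_of G (C - F) w" using D(1) by (auto simp: \<D>_def Q_def)
    have "D \<subseteq> V - F'" using Dsub[OF D(1)] C(1) D(3) by blast
    moreover have "reach G D x y"
      using conn_component[OF w(1), of G] x(1) y(1) unfolding conn_set_def w(2)[symmetric] by blast
    ultimately have xy: "reach G (V - F') x y" using reach_mono[of G D x y] by blast
    have "u \<in> V - F'" "v \<in> V - F'" using x(2) y(2) adj_verts F' by auto
    then have "reach G (V - F') u x" "reach G (V - F') y v"
      using reach_step[OF reach_refl x(2)] reach_step[OF reach_refl adj_sym[OF y(2)]] reach_in[OF xy] by auto
    then show "reach G (V - F') u v" using xy reach_trans by metis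
  qed
  have "outer_nbhd G D0 \<subseteq> V" by (auto simp: outer_nbhd_def)
  then have "card (outer_nbhd G D0) < k" using inf_linked_few[of "outer_nbhd G D0"] link by blast
  moreover have "D0 \<noteq> {}" using D0 self by (auto simp: \<D>_def Q_def)
  moreover have "finite (outer_nbhd G D0)" using nb[OF D0] C(2) F by (meson finite_UnI finite_subset)
  ultimately show False using finite_set_many_nbrs[of D0] finD[OF D0] Dsub[OF D0] C(1) by fastforce
qed

text \<open>By \<open>finite_components\<close>, the infinite set \<open>C - F\<close> is not
  exhausted by its finite components.\<close>

lemma big_component:
  assumes C: "C \<subseteq> V" "infinite C" "finite (outer_nbhd G C)" and F: "finite F"
  shows "\<exists>v\<in>C - F. big_region (component_of G (C - F) v)"
proof -
  have "C - F \<noteq> {v \<in> C - F. finite (component_of G (C - F) v)}"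
    using finite_components[OF C(1,3) F] C(2) F by (metis (no_types, lifting) finite_Diff2)
  then obtain v where "v \<in> C - F" "infinite (component_of G (C - F) v)" by blast
  then show ?thesis using big_region_component[OF C(1,3) F] by blast
qed

end

section \<open>Regions inside which an end cannot be evaded\<close>

locale concentrated_region = sparse_graph +
  fixes \<omega> :: "(nat \<Rightarrow> 'a) set" and C :: "'a set"
  assumes is_end: "\<omega> \<in> graph_ends G" and region: "big_region C"
    and concentrated: "\<And>X. big_region X \<Longrightarrow> X \<subseteq> C \<Longrightarrow> \<exists>R\<in>\<omega>. range R \<subseteq> X"
begin

lemma C_facts: "C \<subseteq> V" "infinite C" "conn_set G C" "finite (outer_nbhd G C)"
  using region by (auto simp: big_region_def)

text \<open>Two infinite components of \<open>C - F\<close> would both contain rays of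
  \<open>\<omega>\<close>, against \<open>two_ends_rays\<close>. So there is one infinite component,
  and the finite ones cover only finitely many vertices.\<close>

lemma cofinite_part:
  assumes F: "finite F"
  shows "\<exists>X. X \<subseteq> C - F \<and> big_region X \<and> finite (C - X)"
proof -
  obtain v where v: "v \<in> C - F" "big_region (component_of G (C - F) v)"
    using big_component[OF C_facts(1,2,4) F] by blast
  have "C - component_of G (C - F) v \<subseteq> F \<union> {x \<in> C - F. finite (component_of G (C - F) x)}"
  proof
    fix x assume x: "x \<in> C - component_of G (C - F) v"
    show "x \<in> F \<union> {x \<in> C - F. finite (component_of G (C - F) x)}"
    proof (rule ccontr)
      assume "\<not> ?thesis"
      then have xF: "x \<in> C - F" and "infinite (component_of G (C - F) x)" using x by auto
      then have big: "big_region (component_of G (C - F) x)"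
        using big_region_component[OF C_facts(1,4) F] by blast
      have sub: "component_of G (C - F) y \<subseteq> C" for y using component_of_subset[of G "C - F" y] by blast
      obtain R R' where R: "R \<in> \<omega>" "range R \<subseteq> component_of G (C - F) v"
        "R' \<in> \<omega>" "range R' \<subseteq> component_of G (C - F) x"
        using concentrated[OF v(2) sub] concentrated[OF big sub] by blast
      have "component_of G (C - F) v = component_of G (C - F) x"
        by (rule two_ends_rays[OF is_end R(1) R(3) C_facts(4) F R(2) R(4)])
      then show False using x reach_refl[OF xF, of G] by (auto simp: component_of_def)
    qed
  qed
  then have "finite (C - component_of G (C - F) v)"
    using finite_components[OF C_facts(1,4) F] F by (meson finite_UnI finite_subset)
  then show ?thesis using v component_of_subset[of G "C - F" v] by blast
qed

lemma Dom_few: "finite (Dom G \<omega>)" "card (Dom G \<omega>) < k"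
  using inf_linked_few[of "Dom G \<omega>"] Dom_inf_linked[OF is_end] by (auto simp: Dom_def)

text \<open>After deleting any finite \<open>F\<close>, almost all of \<open>C\<close> lies in one
  connected set \<open>X\<close>. It contains a neighbour of \<open>v\<close> as well as vertices of
  the ray, so \<open>v\<close> still reaches the ray.\<close>

lemma infinite_degree_Dom:
  assumes v: "v \<in> V" "infinite (nbhd G v \<inter> C)"
  shows "v \<in> Dom G \<omega>"
proof -
  obtain R0 where R0: "R0 \<in> \<omega>" "range R0 \<subseteq> C" using concentrated[OF region] by blast
  \<comment> \<open>A tail missing \<open>v\<close> is taken, as \<open>dominates_rayI\<close> asks
    for.\<close>
  obtain i where i: "\<forall>n\<ge>i. R0 n \<notin> {v}" using ray_avoids_finite[OF end_ray[OF is_end R0(1)], of "{v}"] by auto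
  define R where "R = (\<lambda>n. R0 (n + i))"
  have R: "R \<in> \<omega>" "range R \<subseteq> C" "is_ray G R"
    using end_tail[OF is_end R0(1)] R0(2) end_ray[OF is_end] by (auto simp: R_def)
  have vR: "v \<notin> range R"
  proof
    assume "v \<in> range R"
    then obtain n where "v = R0 (n + i)" by (auto simp: R_def)
    then show False using i[rule_format, of "n + i"] by simp
  qed
  have "dominates_ray G v R"
  proof (rule dominates_rayI[OF vR])
    fix F assume F: "finite F" "v \<notin> F"
    obtain X where X: "X \<subseteq> C - F" "big_region X" "finite (C - X)" using cofinite_part[OF F(1)] by blast
    have "infinite (nbhd G v \<inter> C - (C - X))" using v(2) X(3) by simp
    then obtain w where "w \<in> nbhd G v \<inter> C - (C - X)" using infinite_imp_nonempty by blast
    then have w: "w \<in> X" "adj G v w" by (auto simp: nbhd_iff)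
    obtain j where "\<forall>n\<ge>j. R n \<notin> C - X" using ray_avoids_finite[OF R(3) X(3)] by blast
    then have j: "R j \<in> X" using R(2) by auto
    have XV: "X \<subseteq> V - F" using X C_facts(1) by blast
    then have "reach G (V - F) w (R j)"
      using X(2) w(1) j reach_mono unfolding big_region_def conn_set_def by metis
    moreover have "reach G (V - F) v w"
      using reach_step[OF reach_refl w(2), of "V - F"] v(1) F(2) w(1) XV by blast
    ultimately show "\<exists>i. reach G (V - F) v (R i)" using reach_trans by metis
  qed
  then show ?thesis using R(1) v(1) by (auto simp: Dom_def)
qed

end

section \<open>Convergent sequences of regions\<close>

lemma minimal_subset:
  assumes "finite A" "P A" shows "\<exists>S. S \<subseteq> A \<and> P S \<and> (\<forall>S'. S' \<subset> S \<longrightarrow> \<not> P S')"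
  using assms
proof (induction A rule: finite_psubset_induct)
  case (psubset A)
  then show ?case by (metis order_refl psubset_imp_subset subset_trans)
qed

text \<open>Local finiteness is only required inside \<open>C\<close>: vertices outside may have infinite degree.\<close>

locale ray_region = sgraph +
  fixes \<omega> :: "(nat \<Rightarrow> 'a) set" and R :: "nat \<Rightarrow> 'a" and C :: "'a set"
  assumes is_end: "\<omega> \<in> graph_ends G" and R_end: "R \<in> \<omega>" and R_C: "range R \<subseteq> C"
    and C_V: "C \<subseteq> V" and C_conn: "conn_set G C"
    and C_fin: "\<And>v. v \<in> C \<Longrightarrow> finite (nbhd G v)"
    and C_bd: "finite {x \<in> C. \<not> nbhd G x \<subseteq> C}"
begin

text \<open>The component of the graph without \<open>S\<close> that contains a tail of
  \<open>R\<close>. Quantifying over the start of the tail avoids a choice; by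
  \<open>tail_comp_eq\<close> any valid start gives the same set.\<close>

definition tail_comp :: "'a set \<Rightarrow> 'a set" where
  "tail_comp S = {w. \<exists>i. (\<forall>n\<ge>i. R n \<notin> S) \<and> reach G (V - S) (R i) w}"

lemma ray: "is_ray G R" using end_ray[OF is_end R_end] .

lemma R_V: "R n \<in> V" using R_C C_V by auto

lemma tail_comp_eq:
  assumes "\<forall>n\<ge>i. R n \<notin> S" shows "tail_comp S = component_of G (V - S) (R i)"
proof -
  have "reach G (V - S) (R i) (R j)" if "\<forall>n\<ge>j. R n \<notin> S" for j
  proof (rule ray_reach[OF ray, of "min i j"])
    show "R n \<in> V - S" if "n \<ge> min i j" for n
      using assms \<open>\<forall>n\<ge>j. R n \<notin> S\<close> R_V that by (cases "n \<ge> i") auto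
  qed auto
  then show ?thesis using assms reach_trans unfolding tail_comp_def component_of_def by fast
qed

lemma tail_comp_obtain:
  assumes "finite S"
  obtains i where "\<forall>n\<ge>i. R n \<notin> S" "tail_comp S = component_of G (V - S) (R i)"
    "\<forall>n\<ge>i. R n \<in> tail_comp S"
proof -
  obtain i where i: "\<forall>n\<ge>i. R n \<notin> S" using ray_avoids_finite[OF ray assms] by blast
  have "R n \<in> tail_comp S" if "n \<ge> i" for n
    unfolding tail_comp_eq[OF i] component_of_def mem_Collect_eq
    by (rule ray_reach[OF ray, of i]) (use i that R_V in auto)
  then show ?thesis using that i tail_comp_eq by blast
qed

lemma tail_comp_subset: "tail_comp S \<subseteq> V - S"
  unfolding tail_comp_def using reach_in by fast

lemma tail_comp_closed:
  assumes "x \<in> tail_comp S" "adj G x y" "y \<notin> S" shows "y \<in> tail_comp S"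
  using assms adj_verts(2)[OF assms(2)] reach_step[of G "V - S" _ x y] unfolding tail_comp_def by blast

text \<open>\<open>B\<close> contains every vertex of \<open>W\<close> with a neighbour outside
  \<open>W\<close>, and may contain more, as it can at the start of the construction.\<close>

definition stage :: "'a set \<Rightarrow> 'a set \<Rightarrow> bool" where
  "stage W B \<longleftrightarrow> W \<subseteq> C \<and> finite B \<and> B \<noteq> {} \<and> B \<subseteq> W \<and> (\<forall>x\<in>W - B. nbhd G x \<subseteq> W) \<and>
     (\<exists>i. \<forall>n\<ge>i. R n \<in> W)"

text \<open>\<open>S\<close> is a minimal set cutting \<open>B\<close> off from the tail of the ray,
  and \<open>W'\<close> is the tail side together with \<open>S\<close>.\<close>

definition next_stage :: "'a set \<Rightarrow> 'a set \<Rightarrow> 'a set \<Rightarrow> 'a set \<Rightarrow> bool" where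
  "next_stage W B W' S \<longleftrightarrow> S \<subseteq> W - B \<and> W' = S \<union> tail_comp S \<and> W' \<subseteq> W - B \<and>
     tail_comp S \<inter> B = {} \<and> (\<forall>S'. S' \<subset> S \<longrightarrow> tail_comp S' \<inter> B \<noteq> {}) \<and>
     S = vertex_boundary G (induce G W') \<and> conn_set G W'"

text \<open>The neighbours of \<open>B\<close> in \<open>W - B\<close> form a finite set
  \<open>S0\<close> that cuts \<open>B\<close> off from the tail of the ray. A minimal subset
  \<open>S\<close> that still does so gives the next stage.\<close>

lemma stage_step:
  assumes st: "stage W B"
  shows "\<exists>W' S. stage W' S \<and> next_stage W B W' S"
proof -
  have W: "W \<subseteq> C" "finite B" "B \<noteq> {}" "B \<subseteq> W" "\<forall>x\<in>W - B. nbhd G x \<subseteq> W"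
    using st by (auto simp: stage_def)
  obtain iW where iW: "\<forall>n\<ge>iW. R n \<in> W" using st by (auto simp: stage_def)
  have enter: "x \<in> B" if "x \<in> W" "y \<notin> W" "adj G x y" for x y
    using W(5) that nbhd_iff[of y x] by blast
  define S0 where "S0 = (\<Union>b\<in>B. nbhd G b \<inter> W) - B"
  have "finite (nbhd G b)" if "b \<in> B" for b using W that C_fin by blast
  then have S0: "finite S0" "S0 \<subseteq> W - B"
    using W(2) by (auto simp: S0_def)
  have "tail_comp S0 \<inter> B = {}"
  proof (rule ccontr)
    assume "\<not> ?thesis"
    then obtain b where b: "b \<in> tail_comp S0" "b \<in> B" by blast
    obtain i0 where i0: "\<forall>n\<ge>i0. R n \<notin> S0" "\<forall>n\<ge>i0. R n \<in> tail_comp S0"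
      using tail_comp_obtain[OF S0(1)] by metis
    obtain i1 where i1: "\<forall>n\<ge>i1. R n \<notin> B" using ray_avoids_finite[OF ray W(2)] by blast
    define i where "i = max i0 (max i1 iW)"
    have "reach G (V - S0) b (R i)"
      using b(1) i0(2) reach_sym reach_trans unfolding i_def
      by (metis component_of_def i0(1) max.cobounded1 mem_Collect_eq tail_comp_eq)
    \<comment> \<open>A step from \<open>B\<close> or from outside \<open>W\<close> into
      \<open>W - B\<close> must start in \<open>B\<close> and land in \<open>S0\<close>. Hence this
      set cannot be left while avoiding \<open>S0\<close>, although the ray ends up in
      \<open>W - B\<close>.\<close>
    then have "R i \<in> - W \<union> B"
    proof (rule reach_closed)
      show "b \<in> - W \<union> B" using b by simp
      fix x y assume xy: "x \<in> - W \<union> B" "x \<in> V - S0" "y \<in> V - S0" "adj G x y"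
      show "y \<in> - W \<union> B"
      proof (rule ccontr)
        assume "\<not> ?thesis"
        then have y: "y \<in> W" "y \<notin> B" by auto
        then have "x \<in> W" using enter[of y x] adj_sym[OF xy(4)] by blast
        then have "x \<in> B" using xy(1) by blast
        then have "y \<in> S0" using y xy(4) by (auto simp: S0_def nbhd_iff)
        then show False using xy(3) by blast
      qed
    qed
    then show False using iW i1 by (auto simp: i_def)
  qed
  then have "\<exists>S. S \<subseteq> S0 \<and> tail_comp S \<inter> B = {} \<and> (\<forall>S'. S' \<subset> S \<longrightarrow> tail_comp S' \<inter> B \<noteq> {})"
    using minimal_subset[OF S0(1), of "\<lambda>S. tail_comp S \<inter> B = {}"] by simp
  then obtain S where S: "S \<subseteq> S0" "tail_comp S \<inter> B = {}" "\<And>S'. S' \<subset> S \<Longrightarrow> tail_comp S' \<inter> B \<noteq> {}"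
    by blast
  have finS: "finite S" and SW: "S \<subseteq> W - B" using S(1) S0 finite_subset by auto
  obtain i where i: "\<forall>n\<ge>i. R n \<notin> S" "tail_comp S = component_of G (V - S) (R i)"
    "\<forall>n\<ge>i. R n \<in> tail_comp S" using tail_comp_obtain[OF finS] by metis
  \<comment> \<open>The component starts in \<open>W\<close> and misses \<open>B\<close>, through
    which every exit from \<open>W\<close> would have to pass.\<close>
  have KW: "tail_comp S \<subseteq> W - B"
  proof
    fix w assume w: "w \<in> tail_comp S"
    define j where "j = max i iW"
    have "R j \<in> tail_comp S" "R j \<in> W" using i(3) iW by (auto simp: j_def)
    then have "reach G (V - S) (R j) w"
      using w reach_sym reach_trans unfolding i(2) component_of_def by (metis mem_Collect_eq)
    then have "w \<in> W \<inter> tail_comp S"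
    proof (rule reach_closed)
      fix x y assume xy: "x \<in> W \<inter> tail_comp S" "x \<in> V - S" "y \<in> V - S" "adj G x y"
      then have "x \<notin> B" using S(2) by blast
      then have "y \<in> W" using enter[of x y] xy by blast
      moreover have "y \<in> tail_comp S" using tail_comp_closed xy by blast
      ultimately show "y \<in> W \<inter> tail_comp S" by blast
    qed (use \<open>R j \<in> W\<close> \<open>R j \<in> tail_comp S\<close> in auto)
    then show "w \<in> W - B" using S(2) by blast
  qed
  define W' where "W' = S \<union> tail_comp S"
  have W'C: "W' \<subseteq> W - B" "W' \<subseteq> V" using SW KW W(1) C_V by (auto simp: W'_def)
  have nbK: "nbhd G x \<subseteq> W'" if "x \<in> W' - S" for x
    using that tail_comp_closed[of x S] nbhd_iff[of _ x] unfolding W'_def by blast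
  text \<open>A vertex \<open>s\<close> of the minimal separator has neighbours on both sides, as \<open>S - {s}\<close> does
    not separate.\<close>
  have sep: "(\<exists>x\<in>tail_comp S. adj G s x) \<and> (\<exists>y\<in>V - W'. adj G s y)" if s: "s \<in> S" for s
  proof -
    have "S - {s} \<subset> S" using s by blast
    then obtain b where b: "b \<in> tail_comp (S - {s})" "b \<in> B" using S(3) by blast
    have T: "\<forall>n\<ge>i. R n \<notin> S - {s}" using i(1) by blast
    have r: "reach G (V - (S - {s})) (R i) b"
      using b(1) unfolding tail_comp_eq[OF T] by (simp add: component_of_def)
    have Ri: "R i \<in> tail_comp S" using i(3) by blast
    have bn: "b \<notin> W'" using b(2) W'C by blast
    have "\<exists>x\<in>tail_comp S. adj G s x"
    proof (rule ccontr)
      assume no: "\<not> ?thesis"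
      have "b \<in> tail_comp S"
      proof (rule reach_closed[OF r Ri])
        fix x y assume xy: "x \<in> tail_comp S" "x \<in> V - (S - {s})" "y \<in> V - (S - {s})" "adj G x y"
        have "y \<noteq> s" using no xy(1) adj_sym[OF xy(4)] by blast
        then show "y \<in> tail_comp S" using tail_comp_closed[OF xy(1,4)] xy(3) by blast
      qed
      then show False using bn by (simp add: W'_def)
    qed
    moreover have "\<exists>y\<in>V - W'. adj G s y"
    proof (rule ccontr)
      assume no: "\<not> ?thesis"
      have "b \<in> tail_comp S \<union> {s}"
      proof (rule reach_closed[OF r])
        show "R i \<in> tail_comp S \<union> {s}" using Ri by blast
        fix x y assume xy: "x \<in> tail_comp S \<union> {s}" "x \<in> V - (S - {s})" "y \<in> V - (S - {s})" "adj G x y"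
        show "y \<in> tail_comp S \<union> {s}"
        proof (cases "x = s")
          case True
          then have "y \<in> W'" using no xy by blast
          then show ?thesis using xy(3) by (auto simp: W'_def)
        next
          case False
          then show ?thesis using tail_comp_closed[of x S y] xy by blast
        qed
      qed
      then show False using bn s by (auto simp: W'_def)
    qed
    ultimately show ?thesis by blast
  qed
  have conn: "conn_set G W'"
  proof -
    have toR: "reach G W' (R i) x" if x: "x \<in> W'" for x
    proof -
      have K: "reach G W' (R i) z" if "z \<in> tail_comp S" for z
        using reach_component[of G "V - S" "R i" z] that reach_mono[of G "tail_comp S" "R i" z W']
        unfolding i(2) component_of_def[of G "V - S"] by (auto simp: W'_def i(2) component_of_def)
      show ?thesis
      proof (cases "x \<in> S")
        case True
        then obtain z where "z \<in> tail_comp S" "adj G x z" using sep by blast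
        then show ?thesis using reach_step[OF K adj_sym] x by blast
      qed (use K x W'_def in auto)
    qed
    then show ?thesis unfolding conn_set_def using i(3) reach_sym reach_trans
      by (metis UnI2 W'_def empty_iff order_refl)
  qed
  have bd: "S = vertex_boundary G (induce G W')"
  proof
    show "S \<subseteq> vertex_boundary G (induce G W')"
      using sep W'C(2) unfolding vertex_boundary_def verts_induce W'_def by blast
    show "vertex_boundary G (induce G W') \<subseteq> S"
      using nbK nbhd_iff unfolding vertex_boundary_def verts_induce by blast
  qed
  \<comment> \<open>With nothing deleted, the connected set \<open>C\<close> would join the ray to
    \<open>B\<close>.\<close>
  have "S \<noteq> {}"
  proof
    assume "S = {}"
    obtain b where b: "b \<in> B" using W(3) by blast
    have "reach G C (R i) b"
      using C_conn R_C b W(1,4) unfolding conn_set_def by blast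
    then have "reach G (V - S) (R i) b" using reach_mono[of G C "R i" b "V - S"] C_V \<open>S = {}\<close> by simp
    then have "b \<in> tail_comp S" unfolding i(2) by (simp add: component_of_def)
    then show False using b S(2) by blast
  qed
  then have "stage W' S"
    unfolding stage_def using W'C W(1) finS nbK i(3) by (auto simp: W'_def)
  moreover have "next_stage W B W' S"
    unfolding next_stage_def using SW W'_def W'C S(2,3) bd conn by blast
  ultimately show ?thesis by blast
qed

lemma stages:
  obtains W S :: "nat \<Rightarrow> 'a set" where "\<And>n. stage (W n) (S n)"
    "\<And>n. next_stage (W n) (S n) (W (Suc n)) (S (Suc n))"
proof -
  \<comment> \<open>The vertex \<open>R 0\<close> makes \<open>B\<close> nonempty even when no
    vertex of \<open>C\<close> has a neighbour outside \<open>C\<close>.\<close>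
  define B where "B = insert (R 0) {x \<in> C. \<not> nbhd G x \<subseteq> C}"
  have start: "stage C B"
    unfolding stage_def using C_bd R_C by (auto simp: B_def)
  have "\<exists>f. \<forall>n. stage (fst (f n)) (snd (f n)) \<and>
    next_stage (fst (f n)) (snd (f n)) (fst (f (Suc n))) (snd (f (Suc n)))"
  proof (rule dependent_nat_choice)
    show "\<exists>x. stage (fst x) (snd x)" using start by (intro exI[of _ "(C, B)"]) simp
  next
    fix x :: "'a set \<times> 'a set" and n :: nat
    assume "stage (fst x) (snd x)"
    then obtain W' S where "stage W' S" "next_stage (fst x) (snd x) W' S" using stage_step by blast
    then show "\<exists>y. stage (fst y) (snd y) \<and> next_stage (fst x) (snd x) (fst y) (snd y)"
      by (intro exI[of _ "(W', S)"]) simp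
  qed
  then obtain f where f: "\<forall>n. stage (fst (f n)) (snd (f n)) \<and>
    next_stage (fst (f n)) (snd (f n)) (fst (f (Suc n))) (snd (f (Suc n)))" by blast
  show thesis by (rule that[of "\<lambda>n. fst (f n)" "\<lambda>n. snd (f n)"]) (use f in auto)
qed

text \<open>A ray in \<open>W'\<close> has a tail in \<open>tail_comp S\<close>, so every ray of its
  end that avoids \<open>S\<close> lies there, away from \<open>B\<close>. For a proper subset of
  \<open>S\<close>, the end \<open>\<omega>\<close> itself shows that separation fails.\<close>

lemma minimal_separator:
  assumes st: "stage W B" "stage W' S" and nx: "next_stage W B W' S" and B: "B = vertex_boundary G (induce G W)"
  shows "is_minimal_separator G (vertex_boundary G (induce G W)) (ends_of_subgraph G (induce G W'))
    (vertex_boundary G (induce G W'))"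
proof -
  have S: "S \<subseteq> W - B" "W' = S \<union> tail_comp S" "tail_comp S \<inter> B = {}"
    "\<And>S'. S' \<subset> S \<Longrightarrow> tail_comp S' \<inter> B \<noteq> {}" "vertex_boundary G (induce G W') = S"
    using nx unfolding next_stage_def by blast+
  have fin: "finite S" "B \<noteq> {}" "S \<subseteq> V" using st C_V by (auto simp: stage_def)
  have nB: "\<not> B \<subseteq> S'" if "S' \<subseteq> S" for S' using S(1) fin(2) that by blast
  obtain i where i: "\<forall>n\<ge>i. R n \<notin> S" "tail_comp S = component_of G (V - S) (R i)"
    "\<forall>n\<ge>i. R n \<in> tail_comp S" using tail_comp_obtain[OF fin(1)] by metis
  have tail: "(\<lambda>n. R (n + i)) \<in> \<omega>" using end_tail[OF is_end R_end] .
  have "is_ray (induce G W') (\<lambda>n. R (n + i))"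
    using ray_tail[OF ray, of i] i(3) S(2) unfolding is_ray_def verts_induce adj_induce by auto
  then have \<omega>in: "\<omega> \<in> ends_of_subgraph G (induce G W')"
    unfolding ends_of_subgraph_def using is_end tail by blast
  have "\<not> is_separator G B (ends_of_subgraph G (induce G W')) S'" if S': "S' \<subset> S" for S'
  proof -
    have T: "\<forall>n\<ge>i. R n \<notin> S'" using i(1) S' by blast
    have "tail_comp S' \<in> comps (del_verts G S')"
      unfolding comps_del_verts tail_comp_eq[OF T] using T R_V by blast
    moreover have "range (\<lambda>n. R (n + i)) \<subseteq> tail_comp S'"
    proof
      fix x assume "x \<in> range (\<lambda>n. R (n + i))"
      then obtain n where n: "x = R (n + i)" by blast
      show "x \<in> tail_comp S'"
        unfolding tail_comp_eq[OF T] component_of_def mem_Collect_eq n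
        by (rule ray_reach[OF ray, of i]) (use T R_V in auto)
    qed
    ultimately show ?thesis
      unfolding is_separator_def using S(4)[OF S'] \<omega>in tail by blast
  qed
  moreover have "is_separator G B (ends_of_subgraph G (induce G W')) S"
    unfolding is_separator_def
  proof (intro conjI)
    show "\<not> (\<exists>K\<in>comps (del_verts G S). K \<inter> B \<noteq> {} \<and>
      (\<exists>\<omega>'\<in>ends_of_subgraph G (induce G W'). \<exists>Q\<in>\<omega>'. range Q \<subseteq> K))"
    proof
      assume "\<exists>K\<in>comps (del_verts G S). K \<inter> B \<noteq> {} \<and>
        (\<exists>\<omega>'\<in>ends_of_subgraph G (induce G W'). \<exists>Q\<in>\<omega>'. range Q \<subseteq> K)"
      then obtain K \<omega>' Q where K: "K \<in> comps (del_verts G S)" "K \<inter> B \<noteq> {}" and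
        \<omega>': "\<omega>' \<in> ends_of_subgraph G (induce G W')" and Q: "Q \<in> \<omega>'" "range Q \<subseteq> K" by blast
      obtain z where z: "K = component_of G (V - S) z" using K(1) by (auto simp: comps_del_verts)
      obtain P where P: "P \<in> \<omega>'" "is_ray (induce G W') P" and \<omega>'e: "\<omega>' \<in> graph_ends G"
        using \<omega>' by (auto simp: ends_of_subgraph_def)
      obtain j where j: "\<forall>n\<ge>j. P n \<notin> S"
        using ray_avoids_finite[OF end_ray[OF \<omega>'e P(1)] fin(1)] by blast
      have "P j \<in> W'" using P(2) by (auto simp: is_ray_def verts_induce)
      then have Pj: "P j \<in> tail_comp S" using j S(2) by auto
      have QS: "Q n \<notin> S" for n using Q(2) z component_of_subset[of G "V - S" z] by auto
      have "reach G (V - S) (P j) (Q 0)"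
        by (rule end_reach[OF \<omega>'e P(1) Q(1) fin(1)]) (use j QS in auto)
      then have "reach G (V - S) (R i) (Q 0)"
        using Pj reach_trans unfolding i(2) component_of_def by fast
      moreover have "reach G (V - S) z (Q 0)" using Q(2) z by (auto simp: component_of_def)
      ultimately have "K = tail_comp S"
        unfolding z i(2) using component_of_eq by metis
      then show False using K(2) S(3) by blast
    qed
  qed (use fin nB in auto)
  ultimately show ?thesis
    unfolding is_minimal_separator_def S(5) B[symmetric] by blast
qed

lemma convergent_sequence:
  obtains W S :: "nat \<Rightarrow> 'a set" where
    "converges_to_end G (\<lambda>n. induce G (W n)) \<omega>"
    "\<And>n. vertex_boundary G (induce G (W n)) = S n"
    "\<And>n. finite (S n)" "\<And>n. S n \<noteq> {}" "\<And>n. S n \<subseteq> W n" "\<And>n. W n \<subseteq> C" "\<And>n. W (Suc n) \<subset> W n"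
    "\<And>n x. x \<in> S n \<Longrightarrow> nbhd G x \<subseteq> C"
    "\<And>n. W n - S n = tail_comp (S n)"
proof -
  obtain W S :: "nat \<Rightarrow> 'a set" where st: "\<And>n. stage (W n) (S n)"
    and nx: "\<And>n. next_stage (W n) (S n) (W (Suc n)) (S (Suc n))"
    using stages by metis
  \<comment> \<open>The sequence skips stage 0: only the later stages are known to be connected and
    to have \<open>S\<close> as exact vertex boundary.\<close>
  define H where "H = (\<lambda>n. induce G (W (Suc n)))"
  have s: "W n \<subseteq> C" "finite (S n)" "S n \<noteq> {}" "S n \<subseteq> W n" "\<forall>x\<in>W n - S n. nbhd G x \<subseteq> W n" for n
    using st[of n] by (auto simp: stage_def)
  have n: "S (Suc n) \<subseteq> W n - S n" "W (Suc n) = S (Suc n) \<union> tail_comp (S (Suc n))"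
    "W (Suc n) \<subseteq> W n - S n" "S (Suc n) = vertex_boundary G (induce G (W (Suc n)))"
    "conn_set G (W (Suc n))" for n
    by (insert nx[of n, unfolded next_stage_def], (elim conjE, assumption)+)
  have WV: "W n \<subseteq> V" for n using s C_V by blast
  have dec: "W (Suc n) \<subset> W n" for n using n(3)[of n] s(3,4)[of n] by blast
  have vH: "verts (H n) = W (Suc n)" for n using WV by (auto simp: H_def verts_induce)
  have "strict_mono (\<lambda>n. - W (Suc n))"
    using dec by (intro strict_mono_Suc_iff[THEN iffD2]) auto
  then have "inj (\<lambda>n. - W (Suc n))" by (rule strict_mono_imp_inj_on)
  then have "inj (\<lambda>n. W (Suc n))" by (auto simp: inj_def)
  then have inj: "inj H" unfolding inj_def using vH by metis
  have region: "is_region G \<omega> (H n)" for n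
    unfolding is_region_def
  proof (intro conjI)
    show "is_subgraph (H n) G" unfolding H_def by (rule induce_subgraph[OF simple])
    show "H n = induce G (verts (H n))" using vH by (simp add: H_def)
    show "connected_graph (H n)" unfolding H_def connected_graph_induce[OF WV] by (rule n(5))
    show "finite (vertex_boundary G (H n))" using n(4)[of n] s(2)[of "Suc n"] by (simp add: H_def)
    obtain i where i: "\<forall>l\<ge>i. R l \<in> tail_comp (S (Suc n))" using tail_comp_obtain[OF s(2)] by metis
    have "is_ray (H n) (\<lambda>l. R (l + i))"
      using ray_tail[OF ray, of i] i n(2)[of n] unfolding is_ray_def H_def verts_induce adj_induce by auto
    then show "\<exists>R\<in>\<omega>. is_ray (H n) R" using end_tail[OF is_end R_end] by blast
  qed
  have sub: "is_subgraph (H (Suc i)) (del_verts (H i) (vertex_boundary G (H i)))" for i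
  proof -
    have "vertex_boundary G (H i) = S (Suc i)" using n(4)[of i] by (simp add: H_def)
    then show ?thesis
      unfolding is_subgraph_def del_verts_simps vH
      using n(3)[of "Suc i"] simple_graph_induce[OF simple] WV[of "Suc i"]
      by (auto simp: H_def del_verts_def induce_def)
  qed
  have ms: "is_minimal_separator G (vertex_boundary G (H i))
    (ends_of_subgraph G (H (Suc i))) (vertex_boundary G (H (Suc i)))" for i
    unfolding H_def by (rule minimal_separator[OF st st nx n(4)])
  show thesis
  proof (rule that[of "\<lambda>n. W (Suc n)" "\<lambda>n. S (Suc n)"])
    show "converges_to_end G (\<lambda>n. induce G (W (Suc n))) \<omega>"
      using inj region sub ms unfolding converges_to_end_def H_def by blast
    \<comment> \<open>A boundary vertex is an interior vertex of the previous stage, which contains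
      all its neighbours.\<close>
    show "nbhd G x \<subseteq> C" if "x \<in> S (Suc l)" for l x
      using that n(1)[of l] s(1,5)[of l] by blast
    show "W (Suc l) - S (Suc l) = tail_comp (S (Suc l))" for l
      using n(2)[of l] tail_comp_subset[of "S (Suc l)"] by blast
  qed (use n(4)[symmetric] s dec in auto)
qed

end

section \<open>Counting degrees along a convergent sequence\<close>

lemma reach_del_verts:
  assumes "U \<subseteq> verts G - D" shows "reach (del_verts G D) U u v \<longleftrightarrow> reach G U u v"
proof -
  have "(\<lambda>x y. adj (del_verts G D) x y \<and> x \<in> U \<and> y \<in> U) = (\<lambda>x y. adj G x y \<and> x \<in> U \<and> y \<in> U)"
    using assms by (auto simp: del_verts_simps fun_eq_iff)
  then show ?thesis by (simp add: reach_def)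
qed

lemma simple_del_verts: "simple_graph G \<Longrightarrow> simple_graph (del_verts G D)"
  by (simp add: del_verts_def simple_graph_induce)

text \<open>Rays of \<open>\<omega>\<close> that avoid the finite set \<open>Dom G \<omega>\<close>
  remain equivalent after deleting it, because this set can be added to any finite \<open>S\<close>.
  This resolves the definite description.\<close>

lemma (in sgraph) induced_end_eq:
  assumes \<omega>: "\<omega> \<in> graph_ends G" "R \<in> \<omega>" and fin: "finite (Dom G \<omega>)"
    and R: "is_ray (undominated_part G \<omega>) R"
  shows "induced_end G \<omega> = ray_equiv (undominated_part G \<omega>) `` {R}"
proof -
  define D where "D = Dom G \<omega>"
  have U: "undominated_part G \<omega> = del_verts G D" by (simp add: undominated_part_def D_def)
  interpret U: sgraph "del_verts G D" by unfold_locales (rule simple_del_verts[OF simple])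
  show ?thesis unfolding induced_end_def U
  proof (rule the_equality)
    show "ray_equiv (del_verts G D) `` {R} \<in> graph_ends (del_verts G D) \<and>
        ray_equiv (del_verts G D) `` {R} \<inter> \<omega> \<noteq> {}"
      using U.end_of_ray[of R] R \<omega>(2) unfolding U by blast
  next
    fix \<omega>' assume "\<omega>' \<in> graph_ends (del_verts G D) \<and> \<omega>' \<inter> \<omega> \<noteq> {}"
    then obtain R' where R': "\<omega>' \<in> graph_ends (del_verts G D)" "R' \<in> \<omega>'" "R' \<in> \<omega>" by blast
    have r: "is_ray (del_verts G D) R" "is_ray (del_verts G D) R'"
      using R U.end_ray[OF R'(1,2)] unfolding U by auto
    then have nD: "R n \<notin> D" "R' n \<notin> D" for n by (auto simp: is_ray_def del_verts_simps)
    have "(R, R') \<in> ray_equiv (del_verts G D)" unfolding U.ray_equiv_iff[OF r]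
    proof (intro allI impI)
      fix S i j assume S: "finite S" and i: "\<forall>n\<ge>i. R n \<notin> S" and j: "\<forall>n\<ge>j. R' n \<notin> S"
      have "reach G (V - (D \<union> S)) (R i) (R' j)"
        by (rule end_reach[OF \<omega> R'(3)]) (use S fin i j nD D_def in auto)
      moreover have "V - (D \<union> S) = verts (del_verts G D) - S" by (auto simp: del_verts_simps)
      ultimately show "reach (del_verts G D) (verts (del_verts G D) - S) (R i) (R' j)"
        by (subst reach_del_verts) (auto simp: del_verts_simps)
    qed
    then have "R \<in> \<omega>'" using U.end_equiv[OF R'(1,2), of R] U.equiv_ray_equiv
      by (meson equivE symD)
    then show "\<omega>' = ray_equiv (del_verts G D) `` {R}" by (rule U.end_eq_class[OF R'(1)])
  qed
qed

text \<open>The strict bound passes from the infimum to the liminf of the given sequence, and from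
  there to almost all of its quotients. Denominators are cleared for the later count over
  rationals.\<close>

lemma relative_degree_ratio:
  fixes m :: rat
  assumes deg: "ereal (of_rat m) < relative_degree G \<omega>" and fin: "finite (Dom G \<omega>)"
    and R: "R \<in> \<omega>" "is_ray (undominated_part G \<omega>) R"
    and H: "converges_to_end (undominated_part G \<omega>) H (induced_end G \<omega>)"
    and finE: "\<And>n. finite (edge_boundary (undominated_part G \<omega>) (H n))"
    and finS: "\<And>n. finite (vertex_boundary (undominated_part G \<omega>) (H n))"
    and neS: "\<And>n. vertex_boundary (undominated_part G \<omega>) (H n) \<noteq> {}"
  shows "\<forall>\<^sub>F n in sequentially. (m - of_nat (card (Dom G \<omega>))) *
    of_nat (card (vertex_boundary (undominated_part G \<omega>) (H n)))
      < of_nat (card (edge_boundary (undominated_part G \<omega>) (H n)))"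
proof -
  define e v where "e = (\<lambda>n. card (edge_boundary (undominated_part G \<omega>) (H n)))"
    and "v = (\<lambda>n. card (vertex_boundary (undominated_part G \<omega>) (H n)))"
  define d where "d = card (Dom G \<omega>)"
  define q where "q = (\<lambda>H. liminf (\<lambda>i. ereal_of_enat (ecard (edge_boundary (undominated_part G \<omega>) (H i))) /
             ereal_of_enat (ecard (vertex_boundary (undominated_part G \<omega>) (H i)))))"
  have c: "\<not> ((\<nexists>R. R \<in> \<omega> \<and> is_ray (undominated_part G \<omega>) R) \<or> infinite (Dom G \<omega>))"
    using R fin by blast
  have "ereal (of_rat m) < ereal (real d) +
    (INF H\<in>{H. converges_to_end (undominated_part G \<omega>) H (induced_end G \<omega>)}. q H)"
    using deg fin unfolding relative_degree_def if_not_P[OF c] d_def q_def ecard_def by simp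
  also have "\<dots> \<le> ereal (real d) + q H"
    using H by (intro add_left_mono INF_lower) simp
  also have "q H = liminf (\<lambda>i. ereal (real (e i) / real (v i)))"
    unfolding q_def e_def v_def ecard_def using finE finS neS by simp
  finally have "ereal (of_rat m) < ereal (real d) + liminf (\<lambda>i. ereal (real (e i) / real (v i)))" .
  then have "ereal (of_rat m - real d) < liminf (\<lambda>i. ereal (real (e i) / real (v i)))"
    by (cases "liminf (\<lambda>i. ereal (real (e i) / real (v i)))") auto
  then have ev: "\<forall>\<^sub>F n in sequentially. ereal (of_rat m - real d) < ereal (real (e n) / real (v n))"
    by (rule less_LiminfD)
  have "(m - of_nat d) * of_nat (v n) < of_nat (e n)" if "of_rat m - real d < real (e n) / real (v n)" for n
  proof -
    have "v n > 0" using finS[of n] neS[of n] by (simp add: v_def card_gt_0_iff)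
    then have "(of_rat m - real d) * real (v n) < real (e n)" using that by (simp add: pos_less_divide_eq)
    then have "(of_rat ((m - of_nat d) * of_nat (v n)) :: real) < of_rat (of_nat (e n))"
      by (simp add: of_rat_mult of_rat_diff)
    then show ?thesis by (simp only: of_rat_less)
  qed
  then show ?thesis using ev unfolding e_def v_def d_def by (auto elim!: eventually_mono)
qed

context concentrated_region
begin

text \<open>Otherwise the finite sets \<open>A n\<close> become too dense. Vertices of
  \<open>P n\<close> exceed the slope \<open>m - card D\<close> by a fixed \<open>\<epsilon>\<close>
  up to a bounded total loss, those of \<open>S n\<close> exceed it on average for large
  \<open>n\<close>, and \<open>P n\<close> grows without bound.\<close>

lemma relative_degree_le: "relative_degree G \<omega> \<le> ereal (of_rat m)"
proof (rule ccontr)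
  assume "\<not> ?thesis"
  then have deg: "ereal (of_rat m) < relative_degree G \<omega>" by simp
  define D where "D = Dom G \<omega>"
  have D: "finite D" "card D < k" using Dom_few by (auto simp: D_def)
  \<comment> \<open>\<open>X\<close> is \<open>C - D\<close> up to finitely many vertices and still
    connected.\<close>
  obtain X where X: "X \<subseteq> C - D" "big_region X" "finite (C - X)" using cofinite_part[OF D(1)] by blast
  have XV: "X \<subseteq> V - D" and Xc: "conn_set G X" and Xn: "finite (outer_nbhd G X)"
    using X C_facts(1) by (auto simp: big_region_def)
  obtain R where R: "R \<in> \<omega>" "range R \<subseteq> X" using concentrated[OF X(2)] X(1) by blast
  define G' where "G' = del_verts G D"
  have U: "undominated_part G \<omega> = G'" by (simp add: undominated_part_def D_def G'_def)
  interpret G': sgraph G' unfolding G'_def by unfold_locales (rule simple_del_verts[OF simple])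
  have V': "verts G' = V - D" by (simp add: G'_def del_verts_simps)
  have adj': "adj G' x y \<longleftrightarrow> adj G x y \<and> x \<notin> D \<and> y \<notin> D" for x y
    using adj_verts by (auto simp: G'_def del_verts_simps)
  have nb': "nbhd G' x = nbhd G x - D" if "x \<notin> D" for x
    using that by (auto simp: nbhd_iff G'.nbhd_iff adj')
  have reach': "reach G' U x y \<longleftrightarrow> reach G U x y" if "U \<subseteq> V - D" for U x y
    unfolding G'_def by (rule reach_del_verts[OF that])
  have ray': "is_ray G' R"
    using end_ray[OF is_end R(1)] R(2) XV unfolding is_ray_def adj' V' by blast
  define \<omega>' where "\<omega>' = ray_equiv G' `` {R}"
  have ind: "induced_end G \<omega> = \<omega>'"
    using induced_end_eq[OF is_end R(1)] D(1) ray' unfolding U \<omega>'_def D_def by blast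
  \<comment> \<open>A vertex with infinitely many neighbours in \<open>C\<close> would dominate
    \<open>\<omega>\<close>, but \<open>X\<close> avoids \<open>D\<close>. The other neighbours lie
    in the finite outer neighbourhood of \<open>C\<close>.\<close>
  have fin_nb: "finite (nbhd G v)" if "v \<in> X" for v
  proof -
    have "v \<in> V" "v \<in> C" "v \<notin> D" using that XV X(1) by auto
    then have "finite (nbhd G v \<inter> C)" using infinite_degree_Dom D_def by blast
    moreover have "nbhd G v \<subseteq> (nbhd G v \<inter> C) \<union> outer_nbhd G C"
      using \<open>v \<in> C\<close> by (auto simp: nbhd_def outer_nbhd_def)
    ultimately show ?thesis using C_facts(4) by (meson finite_UnI finite_subset)
  qed
  \<comment> \<open>The edges of \<open>G'\<close> leaving \<open>X\<close> have their outer ends in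
    \<open>B\<close> and their inner ends in \<open>Z\<close>. As no vertex of \<open>B\<close>
    dominates \<open>\<omega>\<close>, each has finitely many neighbours in \<open>C\<close>, so
    \<open>Z\<close> is finite.\<close>
  define B where "B = outer_nbhd G X - D"
  define Z where "Z = {x \<in> X. \<not> nbhd G' x \<subseteq> X}"
  have finB: "finite B" using Xn by (simp add: B_def)
  have "Z \<subseteq> (\<Union>b\<in>B. nbhd G b \<inter> C)"
  proof
    fix x assume "x \<in> Z"
    then obtain b where x: "x \<in> X" and b: "adj G x b" "b \<notin> D" "b \<notin> X"
      using G'.nbhd_iff adj' unfolding Z_def by blast
    then have "b \<in> B" using adj_verts(2)[OF b(1)] by (auto simp: B_def outer_nbhd_def)
    moreover have "x \<in> nbhd G b \<inter> C" using adj_sym[OF b(1)] x X(1) by (auto simp: nbhd_iff)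
    ultimately show "x \<in> (\<Union>b\<in>B. nbhd G b \<inter> C)" by blast
  qed
  moreover have "finite (nbhd G b \<inter> C)" if "b \<in> B" for b
    using infinite_degree_Dom[of b] that D_def by (auto simp: B_def outer_nbhd_def)
  ultimately have finZ: "finite Z" using finB by (meson finite_UN_I finite_subset)
  interpret reg: ray_region G' \<omega>' R X
  proof
    show "\<omega>' \<in> graph_ends G'" "R \<in> \<omega>'" unfolding \<omega>'_def by (rule G'.end_of_ray[OF ray'])+
    show "range R \<subseteq> X" by (rule R(2))
    show "X \<subseteq> verts G'" using XV V' by simp
    show "conn_set G' X" using Xc reach'[OF XV] by (simp add: conn_set_def)
    show "finite (nbhd G' v)" if "v \<in> X" for v
      using fin_nb[OF that] nb'[of v] that XV by auto
    show "finite {x \<in> X. \<not> nbhd G' x \<subseteq> X}" using finZ by (simp add: Z_def)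
  qed
  obtain W S :: "nat \<Rightarrow> 'a set" where conv: "converges_to_end G' (\<lambda>n. induce G' (W n)) \<omega>'"
    and bd: "\<And>n. vertex_boundary G' (induce G' (W n)) = S n"
    and S: "\<And>n. finite (S n)" "\<And>n. S n \<noteq> {}" "\<And>n. S n \<subseteq> W n" "\<And>n. W n \<subseteq> X"
      "\<And>n. W (Suc n) \<subset> W n" "\<And>n x. x \<in> S n \<Longrightarrow> nbhd G' x \<subseteq> X"
    and tail: "\<And>n. W n - S n = reg.tail_comp (S n)"
    using reg.convergent_sequence by metis
  define P where "P = (\<lambda>n. X - W n)"
  define A where "A = (\<lambda>n. P n \<union> S n)"
  have A_eq: "A n = X - reg.tail_comp (S n)" for n using S(3,4)[of n] by (auto simp: A_def P_def tail[symmetric])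
  \<comment> \<open>Almost all of \<open>C\<close> forms a connected set \<open>Y\<close> avoiding
    \<open>S n\<close> and \<open>D\<close>. It meets the tail of the ray, so it lies in the tail
    component and \<open>A n\<close> is contained in \<open>C - Y\<close>.\<close>
  have finA: "finite (A n)" for n
  proof -
    obtain Y where Y: "Y \<subseteq> C - (S n \<union> D)" "big_region Y" "finite (C - Y)"
      using cofinite_part[of "S n \<union> D"] S(1) D(1) by blast
    obtain i where i: "\<forall>l\<ge>i. R l \<notin> S n \<union> (C - Y)"
      using ray_avoids_finite[OF end_ray[OF is_end R(1)]] S(1)[of n] Y(3) by (meson finite_UnI)
    have RiY: "R i \<in> Y" using i R(2) X(1) by auto
    have "Y \<subseteq> reg.tail_comp (S n)"
    proof
      fix y assume "y \<in> Y"
      then have "reach G Y (R i) y" using Y(2) RiY by (auto simp: big_region_def conn_set_def)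
      moreover have "Y \<subseteq> verts G' - S n" using Y(1) C_facts(1) V' by auto
      ultimately have "reach G (verts G' - S n) (R i) y" by (rule reach_mono)
      then have "reach G' (verts G' - S n) (R i) y" by (subst reach') (auto simp: V')
      then show "y \<in> reg.tail_comp (S n)" unfolding reg.tail_comp_def using i by auto
    qed
    then have "A n \<subseteq> C - Y" unfolding A_eq using X(1) by blast
    then show ?thesis using Y(3) finite_subset by blast
  qed
  have finP: "finite (P n)" for n using finA[of n] by (simp add: A_def)
  have cardP: "n \<le> card (P n)" for n
  proof (induction n)
    case (Suc n)
    have "P n \<subset> P (Suc n)" using S(4)[of n] S(5)[of n] by (auto simp: P_def)
    then show ?case using Suc psubset_card_mono[OF finP] by (metis Suc_leI le_less_trans)
  qed simp
  have AX: "A n \<subseteq> X" for n using S(3,4)[of n] by (auto simp: A_def P_def)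
  define E where "E = (\<lambda>n. edge_boundary G' (induce G' (W n)))"
  \<comment> \<open>In \<open>G'\<close>, an edge leaving \<open>W n\<close> has its inner end in
    \<open>S n\<close> and its outer end in \<open>P n\<close>. So it contributes to the degree of a
    vertex of \<open>S n\<close> inside \<open>A n\<close>.\<close>
  have E: "finite (E n)" "card (E n) \<le> (\<Sum>s\<in>S n. card (nbhd G s \<inter> A n))" for n
  proof -
    let ?U = "\<Union>s\<in>S n. (\<lambda>w. {s, w}) ` (nbhd G s \<inter> A n)"
    have sub: "E n \<subseteq> ?U"
    proof
      fix e assume "e \<in> E n"
      then obtain u v where uv: "u \<in> W n" "v \<in> verts G' - W n" "e = {u, v}" "adj G' u v"
        using S(4)[of n] XV unfolding E_def edge_boundary_def verts_induce by (auto simp: adj_def V')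
      have "u \<in> S n" unfolding bd[symmetric] vertex_boundary_def verts_induce
        using uv G'.adj_verts by blast
      moreover have "v \<in> X" using S(6)[OF \<open>u \<in> S n\<close>] uv(4) by (auto simp: G'.nbhd_iff)
      moreover have "v \<in> nbhd G u" using uv(4) by (simp add: nbhd_iff adj')
      ultimately show "e \<in> ?U" using uv(2,3) unfolding A_def P_def by blast
    qed
    have fU: "finite ?U" using S(1) finA by blast
    have cU: "card ?U \<le> (\<Sum>s\<in>S n. card (nbhd G s \<inter> A n))"
      by (rule order_trans[OF card_UN_le[OF S(1)] sum_mono]) (simp add: card_image_le finA)
    show "finite (E n)" by (rule finite_subset[OF sub fU])
    show "card (E n) \<le> (\<Sum>s\<in>S n. card (nbhd G s \<inter> A n))"
      by (rule order_trans[OF card_mono[OF fU sub] cU])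
  qed
  \<comment> \<open>Neighbours in \<open>B\<close> lie neither in \<open>A n\<close> nor in
    \<open>D\<close>. Among the vertices of \<open>X\<close> only those of \<open>Z\<close> have
    any, so \<open>c\<close> bounds the total loss for all \<open>n\<close> at once.\<close>
  define loss where "loss = (\<lambda>v. card (nbhd G v \<inter> B))"
  define c where "c = (\<Sum>v\<in>Z. loss v)"
  \<comment> \<open>A finite degree above \<open>m\<close> is an integer and hence at least
    \<open>\<lfloor>m\<rfloor> + 1\<close>, which is \<open>m + \<epsilon>\<close>.\<close>
  define \<epsilon> :: rat where "\<epsilon> = of_int \<lfloor>m\<rfloor> + 1 - m"
  have \<epsilon>: "\<epsilon> > 0" unfolding \<epsilon>_def by linarith
  \<comment> \<open>A neighbour of \<open>v\<close> outside \<open>A n\<close>, \<open>D\<close> and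
    \<open>B\<close> would lie in the tail component and draw \<open>v\<close> into it.\<close>
  have inner: "m + \<epsilon> \<le> of_nat (card (nbhd G v \<inter> A n)) + of_nat (card D) + of_nat (loss v)"
    if v: "v \<in> P n" for v n
  proof -
    have vX: "v \<in> X" "v \<notin> W n" "v \<notin> D" using v XV by (auto simp: P_def)
    have fin: "finite (nbhd G v)" using fin_nb vX by blast
    have "nbhd G v \<subseteq> (nbhd G v \<inter> A n) \<union> (D \<union> (nbhd G v \<inter> B))"
    proof
      fix w assume w: "w \<in> nbhd G v"
      then have a: "adj G v w" "w \<in> V" by (auto simp: nbhd_def)
      show "w \<in> (nbhd G v \<inter> A n) \<union> (D \<union> (nbhd G v \<inter> B))"
      proof (rule ccontr)
        assume n: "\<not> ?thesis"
        then have "w \<in> X" using a vX(1) w by (auto simp: B_def outer_nbhd_def)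
        then have "w \<in> reg.tail_comp (S n)" using n w unfolding A_eq by blast
        moreover have "adj G' w v" using n vX(3) a(1) adj_sym[of G v w] by (auto simp: adj')
        moreover have "v \<notin> S n" using vX(2) S(3) by blast
        ultimately have "v \<in> reg.tail_comp (S n)" by (rule reg.tail_comp_closed)
        then show False using vX(2) tail[of n] by blast
      qed
    qed
    then have "card (nbhd G v) \<le> card ((nbhd G v \<inter> A n) \<union> (D \<union> (nbhd G v \<inter> B)))"
      using fin D(1) by (intro card_mono) auto
    also have "\<dots> \<le> card (nbhd G v \<inter> A n) + card (D \<union> (nbhd G v \<inter> B))" by (rule card_Un_le)
    also have "card (D \<union> (nbhd G v \<inter> B)) \<le> card D + loss v" unfolding loss_def by (rule card_Un_le)
    finally have le: "card (nbhd G v) \<le> card (nbhd G v \<inter> A n) + (card D + loss v)" by simp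
    have "m < of_int (int (card (nbhd G v)))" using degree[of v] fin vX(1) XV by auto
    then have "\<lfloor>m\<rfloor> + 1 \<le> int (card (nbhd G v))" by (simp add: floor_less_iff[symmetric] del: of_int_of_nat_eq)
    also have "\<dots> \<le> int (card (nbhd G v \<inter> A n) + (card D + loss v))" using le by simp
    finally have "(of_int (\<lfloor>m\<rfloor> + 1) :: rat) \<le> of_int (int (card (nbhd G v \<inter> A n) + (card D + loss v)))"
      by (simp only: of_int_le_iff)
    then show ?thesis by (simp add: \<epsilon>_def add.assoc)
  qed
  have loss_sum: "(\<Sum>v\<in>P n. loss v) \<le> c" for n
  proof -
    have "loss v = 0" if "v \<in> P n - Z" for v
    proof -
      have "v \<in> X" "v \<notin> Z" "v \<notin> D" using that XV by (auto simp: P_def)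
      then have "nbhd G v - D \<subseteq> X" using nb'[of v] by (auto simp: Z_def)
      then have "nbhd G v \<inter> B = {}" by (auto simp: B_def outer_nbhd_def)
      then show ?thesis by (simp add: loss_def)
    qed
    then have "(\<Sum>v\<in>P n. loss v) = (\<Sum>v\<in>P n \<inter> Z. loss v)"
      using finP by (intro sum.mono_neutral_right) auto
    also have "\<dots> \<le> c" unfolding c_def using finZ by (intro sum_mono2) auto
    finally show ?thesis .
  qed
  have bound: "\<epsilon> * of_nat (card (P n)) \<le> of_nat c"
    if ratio: "(m - of_nat (card D)) * of_nat (card (S n)) < of_nat (card (E n))" for n
  proof -
    define d :: rat where "d = of_nat (card D)"
    define p s :: rat where "p = of_nat (card (P n))" and "s = of_nat (card (S n))"
    have disj: "P n \<inter> S n = {}" using S(3)[of n] by (auto simp: P_def)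
    have "(m + \<epsilon> - d) * p = (\<Sum>v\<in>P n. m + \<epsilon> - d)" by (simp add: p_def mult.commute)
    also have "\<dots> \<le> (\<Sum>v\<in>P n. of_nat (card (nbhd G v \<inter> A n)) + of_nat (loss v))"
      using inner by (intro sum_mono) (force simp: d_def algebra_simps)
    also have "\<dots> = (\<Sum>v\<in>P n. of_nat (card (nbhd G v \<inter> A n))) + of_nat (\<Sum>v\<in>P n. loss v)"
      by (simp add: sum.distrib)
    also have "(of_nat (\<Sum>v\<in>P n. loss v) :: rat) \<le> of_nat c" using loss_sum of_nat_mono by blast
    finally have 1: "(m + \<epsilon> - d) * p - of_nat c \<le> (\<Sum>v\<in>P n. of_nat (card (nbhd G v \<inter> A n)))" by simp
    have "(m - d) * s \<le> of_nat (\<Sum>v\<in>S n. card (nbhd G v \<inter> A n))"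
      using ratio E(2)[of n] unfolding d_def s_def by (meson less_imp_le of_nat_mono order_trans)
    then have 2: "(m - d) * s \<le> (\<Sum>v\<in>S n. of_nat (card (nbhd G v \<inter> A n)))" by simp
    have "(\<Sum>v\<in>A n. of_nat (card (nbhd G v \<inter> A n))) \<le> (m - of_nat k + 1) * (of_nat (card (A n)) :: rat)"
      using finA S(2)[of n] AX[of n] XV by (intro sparse) (auto simp: A_def)
    also have "of_nat (card (A n)) = p + s"
      unfolding A_def p_def s_def using card_Un_disjoint[OF finP S(1) disj] by simp
    finally have 3: "(\<Sum>v\<in>P n. of_nat (card (nbhd G v \<inter> A n))) + (\<Sum>v\<in>S n. of_nat (card (nbhd G v \<inter> A n)))
        \<le> (m - of_nat k + 1) * (p + s)"
      using sum.union_disjoint[OF finP S(1) disj, of "\<lambda>v. of_nat (card (nbhd G v \<inter> A n)) :: rat"]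
      by (simp add: A_def)
    \<comment> \<open>Since \<open>d \<le> k - 1\<close>, the upper bound from \<open>sparse\<close>
      has slope at most \<open>m - d\<close>. Subtracting the two lower bounds cancels this slope
      and leaves only the surplus and the loss.\<close>
    have "d + 1 \<le> of_nat k" using D(2) unfolding d_def by (metis Suc_leI of_nat_Suc of_nat_le_iff add.commute)
    then have "(m - of_nat k + 1) * (p + s) \<le> (m - d) * (p + s)"
      by (intro mult_right_mono) (auto simp: p_def s_def)
    then have "(m + \<epsilon> - d) * p - of_nat c + (m - d) * s \<le> (m - d) * (p + s)" using 1 2 3 by linarith
    then show ?thesis unfolding p_def by (simp add: algebra_simps)
  qed
  have "\<forall>\<^sub>F n in sequentially. (m - of_nat (card D)) * of_nat (card (S n)) < of_nat (card (E n))"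
    using relative_degree_ratio[OF deg _ R(1), of "\<lambda>n. induce G' (W n)"] conv E(1) S(1,2) ray' D(1)
    unfolding U ind bd E_def D_def by blast
  \<comment> \<open>For \<open>n \<ge> N\<close>, the surplus \<open>\<epsilon> * card (P n)\<close>
    exceeds the constant loss \<open>c\<close>.\<close>
  moreover obtain N where N: "of_nat c / \<epsilon> < of_nat N" using reals_Archimedean2 by blast
  ultimately obtain n where n: "n \<ge> N" "(m - of_nat (card D)) * of_nat (card (S n)) < of_nat (card (E n))"
    unfolding eventually_sequentially by (meson linorder_linear order_refl)
  have "of_nat c < of_nat N * \<epsilon>" using N \<epsilon> by (simp add: pos_divide_less_eq)
  also have "\<dots> \<le> of_nat (card (P n)) * \<epsilon>"
    using \<epsilon> cardP[of n] n(1) by (intro mult_right_mono) auto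
  finally show False using bound[OF n(2)] by (simp add: mult.commute)
qed

end

section \<open>Evading all ends\<close>

context sparse_graph
begin

text \<open>If every big region inside the component \<open>X\<close> contained a ray of
  \<open>\<omega>\<close>, then \<open>X\<close> would be a concentrated region, which the relative
  degree forbids.\<close>

lemma evade_end:
  assumes deg: "\<And>\<omega>. \<omega> \<in> graph_ends G \<Longrightarrow> ereal (of_rat m) < relative_degree G \<omega>"
    and C: "big_region C" "finite F"
  shows "\<exists>C'. C' \<subseteq> C - F \<and> big_region C' \<and> (\<omega> \<in> graph_ends G \<longrightarrow> \<not> (\<exists>R\<in>\<omega>. range R \<subseteq> C'))"
proof -
  obtain v where v: "big_region (component_of G (C - F) v)"
    using big_component[of C F] C by (auto simp: big_region_def)
  define X where "X = component_of G (C - F) v"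
  have X: "big_region X" "X \<subseteq> C - F" using v component_of_subset[of G "C - F" v] by (auto simp: X_def)
  show ?thesis
  proof (rule ccontr)
    assume neg: "\<not> ?thesis"
    then have \<omega>: "\<omega> \<in> graph_ends G" using X by blast
    interpret concentrated_region G k m \<omega> X
      using neg X \<omega> by unfold_locales blast+
    show False using relative_degree_le deg[OF \<omega>] by simp
  qed
qed

text \<open>A path from \<open>y\<close> to the evading region \<open>C'\<close> is cut just before
  it enters \<open>C'\<close>. Since \<open>y\<close> was deleted before \<open>C'\<close> was
  chosen, at least one vertex remains.\<close>

lemma evading_path:
  assumes deg: "\<And>\<omega>. \<omega> \<in> graph_ends G \<Longrightarrow> ereal (of_rat m) < relative_degree G \<omega>"
    and C: "big_region C" "y \<in> C"
  shows "\<exists>q C'. is_path G q \<and> hd q = y \<and> set q \<subseteq> C - C' \<and> C' \<subseteq> C \<and> big_region C' \<and>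
    (\<exists>z\<in>C'. adj G (last q) z) \<and> (\<omega> \<in> graph_ends G \<longrightarrow> \<not> (\<exists>R\<in>\<omega>. range R \<subseteq> C'))"
proof -
  obtain C' where C': "C' \<subseteq> C - {y}" "big_region C'" "\<omega> \<in> graph_ends G \<longrightarrow> \<not> (\<exists>R\<in>\<omega>. range R \<subseteq> C')"
    using evade_end[OF deg C(1), of "{y}" \<omega>] by blast
  obtain w where w: "w \<in> C'" using C'(2) by (auto simp: big_region_def conn_set_def)
  have "reach G C y w" "C \<subseteq> V" using C C'(1) w by (auto simp: big_region_def conn_set_def)
  from path_to_set[OF this w] obtain p where p: "is_path G p" "hd p = y" "set p \<subseteq> C" "set p \<inter> C' = {last p}"
    by blast
  have pne: "p \<noteq> []" using p(1) by (simp add: is_path_def)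
  have pd: "p = butlast p @ [last p]" using pne by simp
  have qne: "butlast p \<noteq> []"
  proof
    assume "butlast p = []"
    then have "p = [last p]" using pd by simp
    then have "last p = y" using p(2) by (metis list.sel(1))
    then show False using p(4) C'(1) by blast
  qed
  have a: "successively (adj G) (butlast p @ [last p])" "distinct (butlast p @ [last p])"
    using p(1) pd by (auto simp: is_path_def)
  have "is_path G (butlast p)"
    using a p(1) qne by (auto simp: is_path_def successively_append_iff dest: in_set_butlastD)
  moreover have "hd (butlast p) = y" using p(2) pd qne by (metis hd_append2)
  moreover have "set (butlast p) \<subseteq> C - C'"
  proof
    fix x assume x: "x \<in> set (butlast p)"
    then have "x \<noteq> last p" using a(2) by auto
    then show "x \<in> C - C'" using p(3,4) in_set_butlastD[OF x] by blast
  qed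
  moreover have "adj G (last (butlast p)) (last p)" using a(1) qne by (auto simp: successively_append_iff)
  moreover have "last p \<in> C'" using p(4) by blast
  ultimately show ?thesis using C' by (intro exI[of _ "butlast p"] exI[of _ C']) blast
qed

text \<open>Diagonal argument: a path is extended through decreasing big regions, the
  \<open>n\<close>-th extension entering a region without rays of \<open>e n\<close>. The limit ray
  has a tail in each region, so its end is missing from the enumeration.\<close>

lemma ends_uncountable:
  assumes ne: "V \<noteq> {}"
    and deg: "\<And>\<omega>. \<omega> \<in> graph_ends G \<Longrightarrow> ereal (of_rat m) < relative_degree G \<omega>"
  shows "\<not> countable (graph_ends G)"
proof
  assume "countable (graph_ends G)"
  \<comment> \<open>Only an inclusion is available, so \<open>e n\<close> may fail to be an end;
    hence the guards \<open>e n \<in> graph_ends G\<close> below.\<close>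
  then obtain e :: "nat \<Rightarrow> (nat \<Rightarrow> 'a) set" where e: "graph_ends G \<subseteq> range e"
    using subset_range_from_nat_into by blast
  have outer: "outer_nbhd G V = {}" by (auto simp: outer_nbhd_def)
  \<comment> \<open>A finite \<open>V\<close> has no outside neighbours, forcing
    \<open>k = 0\<close>; but the empty set of pairwise infinitely linked vertices forces
    \<open>0 < k\<close>.\<close>
  have "infinite V"
    using finite_set_many_nbrs[of V] inf_linked_few[of "{}"] ne outer by auto
  then obtain C0 where C0: "big_region C0"
    using big_component[of V "{}"] outer by auto
  then obtain y0 where y0: "y0 \<in> C0" by (auto simp: big_region_def conn_set_def)
  \<comment> \<open>The state is a finished path together with a disjoint big region adjacent to its
    last vertex, in which the path can continue.\<close>
  define good where "good = (\<lambda>x. is_path G (fst x) \<and> set (fst x) \<inter> snd x = {} \<and>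
    (\<exists>z\<in>snd x. adj G (last (fst x)) z) \<and> big_region (snd x))"
  define ext where "ext = (\<lambda>n x y. (\<exists>q. fst y = fst x @ q \<and> q \<noteq> [] \<and> set q \<subseteq> snd x) \<and>
    snd y \<subseteq> snd x \<and> (e n \<in> graph_ends G \<longrightarrow> \<not> (\<exists>R\<in>e n. range R \<subseteq> snd y)))"
  have "\<exists>f. \<forall>n. good (f n) \<and> ext n (f n) (f (Suc n))"
  proof (rule dependent_nat_choice)
    \<comment> \<open>No end is to be evaded yet; \<open>{}\<close> is a placeholder.\<close>
    obtain q C' where q: "is_path G q" "set q \<subseteq> C0 - C'" "big_region C'" "\<exists>z\<in>C'. adj G (last q) z"
      using evading_path[OF deg C0 y0, of "{}"] by blast
    then show "\<exists>x. good x" by (intro exI[of _ "(q, C')"]) (auto simp: good_def)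
  next
    fix x :: "'a list \<times> 'a set" and n assume x: "good x"
    obtain p C where pC: "x = (p, C)" by (cases x)
    have p: "is_path G p" "set p \<inter> C = {}" "big_region C" using x by (auto simp: good_def pC)
    obtain z where z: "z \<in> C" "adj G (last p) z" using x by (auto simp: good_def pC)
    obtain q C' where q: "is_path G q" "hd q = z" "set q \<subseteq> C - C'" "C' \<subseteq> C" "big_region C'"
      "\<exists>z\<in>C'. adj G (last q) z" "e n \<in> graph_ends G \<longrightarrow> \<not> (\<exists>R\<in>e n. range R \<subseteq> C')"
      using evading_path[OF deg p(3) z(1), of "e n"] by blast
    have qne: "q \<noteq> []" using q(1) by (simp add: is_path_def)
    have "is_path G (p @ q)"
      using p(1,2) q(1-3) z(2) by (auto simp: is_path_def successively_append_iff)
    then have "good (p @ q, C')" using p(2) q qne by (auto simp: good_def)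
    moreover have "ext n x (p @ q, C')" using q qne by (auto simp: ext_def pC)
    ultimately show "\<exists>y. good y \<and> ext n x y" by blast
  qed
  then obtain f where f: "\<And>n. good (f n)" "\<And>n. ext n (f n) (f (Suc n))" by blast
  define p where "p = (\<lambda>n. fst (f n))"
  define C where "C = (\<lambda>n. snd (f n))"
  have path: "is_path G (p n)" for n using f(1)[of n] by (simp add: good_def p_def)
  have step: "\<exists>q. p (Suc n) = p n @ q \<and> q \<noteq> [] \<and> set q \<subseteq> C n" "C (Suc n) \<subseteq> C n"
    "e n \<in> graph_ends G \<longrightarrow> \<not> (\<exists>R\<in>e n. range R \<subseteq> C (Suc n))" for n
    using f(2)[of n] by (auto simp: ext_def p_def C_def)
  have later: "C l \<subseteq> C n \<and> (\<exists>q. p l = p n @ q \<and> set q \<subseteq> C n)" if "n \<le> l" for n l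
    using that
  proof (induction l rule: dec_induct)
    case (step l)
    then obtain q where q: "p l = p n @ q" "set q \<subseteq> C n" "C l \<subseteq> C n" by blast
    obtain q' where "p (Suc l) = p l @ q'" "set q' \<subseteq> C l" using \<open>\<And>n. \<exists>q. p (Suc n) = _ @ q \<and> _\<close> by blast
    then show ?case using q \<open>\<And>n. C (Suc n) \<subseteq> C n\<close>[of l]
      by (intro conjI exI[of _ "q @ q'"]) auto
  qed auto
  have len: "n < length (p n)" for n
  proof (induction n)
    case 0
    then show ?case using path[of 0] by (simp add: is_path_def)
  next
    case (Suc n)
    then show ?case using step(1)[of n] by (auto simp: less_Suc_eq_le Suc_le_eq) (metis length_0_conv length_append less_add_same_cancel1 less_trans_Suc neq0_conv)
  qed
  \<comment> \<open>The path \<open>p i\<close> has more than \<open>i\<close> vertices and is a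
    prefix of all later paths, so its entry at \<open>i\<close> is final.\<close>
  define R where "R = (\<lambda>i. p i ! i)"
  have R: "R i = p n ! i" if "i \<le> n" for i n
    using later[OF that] len[of i] by (auto simp: R_def nth_append)
  have len': "i < length (p n)" if "i \<le> n" for i n using len[of n] that by simp
  have ray: "is_ray G R"
    unfolding is_ray_def
  proof (intro conjI allI)
    show "inj R"
    proof (rule injI)
      fix i j assume "R i = R j"
      then have "p (max i j) ! i = p (max i j) ! j" using R[of i "max i j"] R[of j "max i j"] by simp
      then show "i = j" using path[of "max i j"] len'[of _ "max i j"]
        by (simp add: is_path_def nth_eq_iff_index_eq)
    qed
    show "range R \<subseteq> V" using path len nth_mem unfolding R_def is_path_def by blast
    fix n
    show "adj G (R n) (R (Suc n))"
      using path[of "Suc n"] len[of "Suc n"] R[of n "Suc n"] R[of "Suc n" "Suc n"]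
      by (auto simp: is_path_def successively_conv_nth)
  qed
  have tail: "R i \<in> C n" if "i \<ge> length (p n)" for i n
  proof -
    have "n \<le> i" using that len[of n] by simp
    then obtain q where q: "p i = p n @ q" "set q \<subseteq> C n" using later by blast
    then have "R i = q ! (i - length (p n))" "i - length (p n) < length q"
      using that len[of i] by (auto simp: R_def nth_append)
    then show ?thesis using q(2) nth_mem by fastforce
  qed
  define \<omega> where "\<omega> = ray_equiv G `` {R}"
  have \<omega>: "\<omega> \<in> graph_ends G" "R \<in> \<omega>" unfolding \<omega>_def by (rule end_of_ray[OF ray])+
  obtain n where n: "\<omega> = e n" using \<omega>(1) e by blast
  have "(\<lambda>i. R (i + length (p (Suc n)))) \<in> \<omega>" by (rule end_tail[OF \<omega>])
  moreover have "range (\<lambda>i. R (i + length (p (Suc n)))) \<subseteq> C (Suc n)" using tail by auto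
  ultimately show False using step(3)[of n] \<omega>(1) n by blast
qed

end

section \<open>From a failing conclusion to uncountably many ends\<close>

theorem theorem3:
  fixes k :: nat and m :: rat and G :: "'a ugraph"
  assumes "simple_graph G" and "verts G \<noteq> {}"
    and "countable (graph_ends G)"
    and "min_degree_VE_gt G m"
  shows "top_minor (complete_graph k) G \<or>
    (\<exists>H. is_subgraph H G \<and> finite (verts H) \<and> verts H \<noteq> {} \<and>
         average_degree H > m - of_nat k + 1)"
proof (rule ccontr)
  assume neg: "\<not> ?thesis"
  interpret sparse_graph G k m
  proof
    show "simple_graph G" by (rule assms(1))
    show "\<not> top_minor (complete_graph k) G" using neg by blast
  next
    fix A :: "'a set" assume A: "finite A" "A \<noteq> {}" "A \<subseteq> verts G"
    have vA: "verts (induce G A) = A" using A(3) by (auto simp: verts_induce)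
    have nA: "nbhd (induce G A) v = nbhd G v \<inter> A" if "v \<in> A" for v
      using that by (auto simp: nbhd_def adj_induce verts_induce)
    have "average_degree (induce G A) \<le> m - of_nat k + 1"
    proof (rule ccontr)
      assume "\<not> ?thesis"
      then have "\<exists>H. is_subgraph H G \<and> finite (verts H) \<and> verts H \<noteq> {} \<and>
          average_degree H > m - of_nat k + 1"
        using A(1,2) vA induce_subgraph[OF assms(1)] by (intro exI[of _ "induce G A"]) simp
      then show False using neg by blast
    qed
    then have "(\<Sum>v\<in>A. of_nat (card (nbhd G v \<inter> A))) / of_nat (card A) \<le> m - of_nat k + 1"
      unfolding average_degree_def vA using nA by simp
    moreover have "card A > 0" using A by (simp add: card_gt_0_iff)
    ultimately show "(\<Sum>v\<in>A. of_nat (card (nbhd G v \<inter> A))) \<le> (m - of_nat k + 1) * of_nat (card A)"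
      by (simp add: pos_divide_le_eq)
  next
    fix v assume v: "v \<in> verts G" "finite (nbhd G v)"
    then have "ereal (of_rat m) < ereal (real (card (nbhd G v)))"
      using assms(4) by (auto simp: min_degree_VE_gt_def vdegree_def ecard_def)
    then have "(of_rat m :: real) < of_rat (of_nat (card (nbhd G v)))" by simp
    then show "m < of_nat (card (nbhd G v))" by (simp only: of_rat_less)
  qed
  show False
    using ends_uncountable[OF assms(2)] assms(3,4) by (auto simp: min_degree_VE_gt_def)
qed

end
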